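(* Let $r\ge1$ and $\bm{\ell}=(\ell_{ij})_{1\le i\le j\le r}\in\mathbb{Z}_{\ge0}^{r(r+1)/2}$. Then $$\zeta_{\mathrm{A}_r}^{\mathrm{diag}}(-\bm{\ell})=\sum_{(k^{(ij)}_p)}\ \Bigl(\prod_{1\le i<j\le r}\binom{\ell_{ij}}{k^{(ij)}_i,\dots,k^{(ij)}_j}\Bigr)\prod_{i=1}^r(-1)^{\ell_{ii}+K_i}\frac{B_{\ell_{ii}+K_i+1}}{\ell_{ii}+K_i+1},$$ where the sum runs over all families of non-negative integers $k^{(ij)}_p$ ($1\le i<j\le r$, $i\le p\le j$) with $k^{(ij)}_i+\cdots+k^{(ij)}_j=\ell_{ij}$ for every $i<j$, and $$K_i:=\sum_{\substack{1\le p\le i\le q\le r \\ p\ne q}}k^{(pq)}_i.$$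
   Context: The Bernoulli numbers $B_n$ are defined by $\frac{X}{e^X-1}=\sum_{n\ge0}B_n\frac{X^n}{n!}$, and $\binom{\ell}{k_1,\dots,k_n}=\frac{\ell!}{k_1!\cdots k_n!}$ is the multinomial coefficient. For $\bm{s}=(s_{ij})_{1\le i\le j\le r}$, the zeta function of type $\mathrm{A}_r$ is $\zeta_{\mathrm{A}_r}(\bm{s})=\sum_{m_1,\dots,m_r\ge1}\prod_{1\le i\le j\le r}(m_i+\cdots+m_j)^{-s_{ij}}$, continued meromorphically to $\mathbb{C}^{r(r+1)/2}$. Diagonal value: put $s_{ij}=-\ell_{ij}$ for all $i<j$; for $\mathrm{Re}(s_{ii})$ sufficiently large the series still converges, and it continues meromorphically in $(s_{11},\dots,s_{rr})$. Then $\zeta_{\mathrm{A}_r}^{\mathrm{diag}}(-\bm{\ell})$ is the limit of this function as $s_{ii}\to-\ell_{ii}$ for $i=1,\dots,r$ (independent of the order of these limits). *)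

theory Defs
  imports "HOL-Analysis.Analysis"
begin

definition bernoulli :: "nat \<Rightarrow> complex" where
  "bernoulli n = fps_nth (fps_X / (fps_exp 1 - 1)) n * fact n"

definition multinomial :: "nat \<Rightarrow> 'a set \<Rightarrow> ('a \<Rightarrow> nat) \<Rightarrow> complex" where
  "multinomial l A k = fact l / (\<Prod>p\<in>A. fact (k p))"

definition mv_holomorphic_on :: "(complex ^ 'r \<Rightarrow> complex) \<Rightarrow> (complex ^ 'r) set \<Rightarrow> bool" where
  "mv_holomorphic_on f U \<longleftrightarrow>
     (\<forall>z\<in>U. \<exists>D. (f has_derivative D) (at z) \<and> (\<forall>c v. D (c *s v) = c * D v))"

text \<open>
  A meromorphic function is locally a quotient \<open>g / h\<close> of holomorphic functions, where \<open>h\<close> does not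
  vanish identically; its values on the zero set of \<open>h\<close> are not prescribed.
\<close>

definition mv_meromorphic_on :: "(complex ^ 'r \<Rightarrow> complex) \<Rightarrow> (complex ^ 'r) set \<Rightarrow> bool" where
  "mv_meromorphic_on F W \<longleftrightarrow>
     (\<forall>a\<in>W. \<exists>U g h. open U \<and> connected U \<and> a \<in> U \<and>
        mv_holomorphic_on g U \<and> mv_holomorphic_on h U \<and> (\<exists>z\<in>U. h z \<noteq> 0) \<and>
        (\<forall>z\<in>U. h z \<noteq> 0 \<longrightarrow> F z = g z / h z))"

text \<open>
  Since a meromorphic function is represented by a total function, its values at removable
  singularities have to be the right ones before limits can be taken through such points:
  if \<open>F\<close> coincides with a holomorphic function on a dense subset of an open set, then it coincides
  with it on the whole open set.
\<close>

definition mv_removed_singularities :: "(complex ^ 'r \<Rightarrow> complex) \<Rightarrow> bool" where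
  "mv_removed_singularities F \<longleftrightarrow>
     (\<forall>U G. open U \<and> mv_holomorphic_on G U \<and> U \<subseteq> closure {z\<in>U. F z = G z} \<longrightarrow>
        (\<forall>z\<in>U. F z = G z))"

text \<open>
  \<open>iterated_limit F a [i\<^sub>1, \<dots>, i\<^sub>n] s v\<close> means that
  \<open>lim\<^bsub>s\<^sub>i\<^sub>1 \<rightarrow> a\<^sub>i\<^sub>1\<^esub> \<dots> lim\<^bsub>s\<^sub>i\<^sub>n \<rightarrow> a\<^sub>i\<^sub>n\<^esub> F s = v\<close>, where
  each inner limit has to exist for all values of the outer variables sufficiently close to
  (and distinct from) their limit points. The vector \<open>s\<close> supplies the coordinates not in the list;
  it is irrelevant when all coordinates are listed.
\<close>

fun iterated_limit ::
  "(complex ^ 'r \<Rightarrow> complex) \<Rightarrow> complex ^ 'r \<Rightarrow> 'r list \<Rightarrow> complex ^ 'r \<Rightarrow> complex \<Rightarrow> bool" where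
  "iterated_limit F a [] s v \<longleftrightarrow> F s = v"
| "iterated_limit F a (i # is) s v \<longleftrightarrow>
     (\<exists>G. (\<forall>\<^sub>F z in at (a $ i). iterated_limit F a is (\<chi> j. if j = i then z else s $ j) (G z)) \<and>
          (G \<longlongrightarrow> v) (at (a $ i)))"

text \<open>
  The index set \<open>{1..r}\<close> is represented by an arbitrary finite linearly ordered type \<open>'r\<close>, with
  \<open>r = CARD('r) \<ge> 1\<close>. A triangular array indexed by \<open>i \<le> j\<close> is a function of two indices whose
  entries with \<open>i > j\<close> are never used.
\<close>

definition zeta_A_summand ::
  "('r \<Rightarrow> 'r \<Rightarrow> complex) \<Rightarrow> ('r::{finite,linorder} \<Rightarrow> nat) \<Rightarrow> complex" where
  "zeta_A_summand s m = (\<Prod>(i, j)\<in>{(i, j). i \<le> j}. of_nat (\<Sum>k\<in>{i..j}. m k) powr (- s i j))"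

definition diag_array ::
  "('r \<Rightarrow> 'r \<Rightarrow> nat) \<Rightarrow> complex ^ 'r::{finite,linorder} \<Rightarrow> 'r \<Rightarrow> 'r \<Rightarrow> complex" where
  "diag_array l t = (\<lambda>i j. if i = j then t $ i else - of_nat (l i j))"

definition zeta_A_diag_continuation ::
  "('r \<Rightarrow> 'r \<Rightarrow> nat) \<Rightarrow> (complex ^ 'r::{finite,linorder} \<Rightarrow> complex) \<Rightarrow> bool" where
  "zeta_A_diag_continuation l F \<longleftrightarrow>
     mv_meromorphic_on F UNIV \<and> mv_removed_singularities F \<and>
     (\<exists>C. \<forall>t. (\<forall>i. Re (t $ i) > C) \<longrightarrow>
        (zeta_A_summand (diag_array l t) has_sum F t) {m. \<forall>i. m i \<ge> 1})"

text \<open>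
  The limit at \<open>(-\<ell>\<^sub>i\<^sub>i)\<^sub>i\<close> is required to exist, with the same value, both as a simultaneous limit
  and as an iterated limit in every order.
\<close>

definition has_zeta_A_diag :: "('r::{finite,linorder} \<Rightarrow> 'r \<Rightarrow> nat) \<Rightarrow> complex \<Rightarrow> bool" where
  "has_zeta_A_diag l v \<longleftrightarrow>
     (\<exists>F. zeta_A_diag_continuation l F) \<and>
     (\<forall>F. zeta_A_diag_continuation l F \<longrightarrow>
        (let a = (\<chi> i. - of_nat (l i i)) in
           (F \<longlongrightarrow> v) (at a) \<and>
           (\<forall>is. distinct is \<and> set is = UNIV \<longrightarrow> iterated_limit F a is a v)))"

definition zeta_A_diag :: "('r::{finite,linorder} \<Rightarrow> 'r \<Rightarrow> nat) \<Rightarrow> complex" where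
  "zeta_A_diag l = (THE v. has_zeta_A_diag l v)"

text \<open>
  \<open>k i j p\<close> stands for $k^{(ij)}_p$, which exists only for \<open>i < j\<close> and \<open>i \<le> p \<le> j\<close>; families are
  extended by zero so that each one is represented by exactly one function.
\<close>

definition index_families ::
  "('r::{finite,linorder} \<Rightarrow> 'r \<Rightarrow> nat) \<Rightarrow> ('r \<Rightarrow> 'r \<Rightarrow> 'r \<Rightarrow> nat) set" where
  "index_families l =
     {k. (\<forall>i j p. \<not> (i < j \<and> i \<le> p \<and> p \<le> j) \<longrightarrow> k i j p = 0) \<and>
         (\<forall>i j. i < j \<longrightarrow> (\<Sum>p\<in>{i..j}. k i j p) = l i j)}"

definition K_sum :: "('r::{finite,linorder} \<Rightarrow> 'r \<Rightarrow> 'r \<Rightarrow> nat) \<Rightarrow> 'r \<Rightarrow> nat" where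
  "K_sum k i = (\<Sum>(p, q)\<in>{(p, q). p \<le> i \<and> i \<le> q \<and> p \<noteq> q}. k p q i)"

end

theory Submission
  imports Defs "HOL-Complex_Analysis.Complex_Analysis"
begin

text \<open>
  For \<open>i < j\<close> the factors \<open>(m\<^sub>i + \<dots> + m\<^sub>j) ^ l\<^sub>i\<^sub>j\<close> are polynomials; expanding them by the multinomial
  theorem turns the diagonal series into a finite linear combination of the products
  \<open>\<Prod>\<^sub>i \<zeta>(s\<^sub>i - K\<^sub>i)\<close>, whose poles avoid the points \<open>s\<^sub>i = - l\<^sub>i\<^sub>i\<close>. It remains to evaluate
  \<open>\<zeta>(- n) = (- 1)\<^sup>n B\<^sub>n\<^sub>+\<^sub>1 / (n + 1)\<close>. This comes from Riemann's representation
  \<open>\<Gamma>(s) \<zeta>(s) = \<integral>\<^sub>0\<^sup>\<infinity> x\<^sup>s\<^sup>-\<^sup>1 / (e\<^sup>x - 1) dx = \<Sum>\<^sub>k B\<^sub>k / k! / (s + k - 1) + \<integral>\<^sub>1\<^sup>\<infinity> x\<^sup>s\<^sup>-\<^sup>1 / (e\<^sup>x - 1) dx\<close>,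
  where the zero of \<open>1 / \<Gamma>\<close> at \<open>- n\<close> leaves only the term \<open>k = n + 1\<close>. Every other continuation agrees
  with this one by the identity theorem, applied along complex lines.
\<close>

no_notation fps_nth (infixl "$" 75)

subsection \<open>Holomorphic and meromorphic functions of several variables\<close>

lemma mv_holomorphic_on_subset:
  "mv_holomorphic_on f U \<Longrightarrow> V \<subseteq> U \<Longrightarrow> mv_holomorphic_on f V"
  unfolding mv_holomorphic_on_def by blast

lemma mv_holomorphic_on_imp_continuous_on:
  assumes "mv_holomorphic_on f U"
  shows "continuous_on U f"
  using assms unfolding mv_holomorphic_on_def
  by (meson continuous_at_imp_continuous_on has_derivative_continuous)

lemma mv_holomorphic_on_const: "mv_holomorphic_on (\<lambda>_. c) U"
  unfolding mv_holomorphic_on_def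
  by (auto intro!: exI[of _ "\<lambda>_. 0"])

lemma mv_holomorphic_on_nth:
  assumes "g holomorphic_on UNIV"
  shows "mv_holomorphic_on (\<lambda>t. g (t $ i)) U"
  unfolding mv_holomorphic_on_def
proof
  fix z
  have "(g has_field_derivative deriv g (z $ i)) (at (z $ i))"
    using assms holomorphic_derivI by blast
  hence "(g has_derivative (*) (deriv g (z $ i))) (at (z $ i))"
    by (simp add: has_field_derivative_def)
  moreover have "((\<lambda>t. t $ i) has_derivative (\<lambda>v. v $ i)) (at z)"
    by (simp add: bounded_linear_imp_has_derivative bounded_linear_vec_nth)
  ultimately have "((\<lambda>t. g (t $ i)) has_derivative (\<lambda>v. deriv g (z $ i) * v $ i)) (at z)"
    by (rule has_derivative_compose[rotated])
  thus "\<exists>D. ((\<lambda>t. g (t $ i)) has_derivative D) (at z) \<and> (\<forall>c v. D (c *s v) = c * D v)"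
    by (intro exI conjI) (auto simp: mult_ac)
qed

lemma mv_holomorphic_on_add:
  assumes "mv_holomorphic_on f U" "mv_holomorphic_on g U"
  shows "mv_holomorphic_on (\<lambda>z. f z + g z) U"
  unfolding mv_holomorphic_on_def
proof
  fix z assume "z \<in> U"
  with assms obtain D E where "(f has_derivative D) (at z)" "(g has_derivative E) (at z)"
    "\<forall>c v. D (c *s v) = c * D v" "\<forall>c v. E (c *s v) = c * E v"
    unfolding mv_holomorphic_on_def by meson
  thus "\<exists>D. ((\<lambda>z. f z + g z) has_derivative D) (at z) \<and> (\<forall>c v. D (c *s v) = c * D v)"
    by (intro exI[of _ "\<lambda>v. D v + E v"]) (auto intro!: derivative_intros simp: algebra_simps)
qed

lemma mv_holomorphic_on_mult:
  assumes "mv_holomorphic_on f U" "mv_holomorphic_on g U"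
  shows "mv_holomorphic_on (\<lambda>z. f z * g z) U"
  unfolding mv_holomorphic_on_def
proof
  fix z assume "z \<in> U"
  with assms obtain D E where "(f has_derivative D) (at z)" "(g has_derivative E) (at z)"
    "\<forall>c v. D (c *s v) = c * D v" "\<forall>c v. E (c *s v) = c * E v"
    unfolding mv_holomorphic_on_def by meson
  thus "\<exists>D. ((\<lambda>z. f z * g z) has_derivative D) (at z) \<and> (\<forall>c v. D (c *s v) = c * D v)"
    by (intro exI[of _ "\<lambda>v. f z * E v + D v * g z"] conjI has_derivative_mult)
       (simp_all add: algebra_simps)
qed

lemma mv_holomorphic_on_inverse:
  assumes "mv_holomorphic_on f U" "\<And>z. z \<in> U \<Longrightarrow> f z \<noteq> 0"
  shows "mv_holomorphic_on (\<lambda>z. inverse (f z)) U"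
  unfolding mv_holomorphic_on_def
proof
  fix z assume z: "z \<in> U"
  with assms obtain D where "(f has_derivative D) (at z)" "\<forall>c v. D (c *s v) = c * D v"
    unfolding mv_holomorphic_on_def by meson
  thus "\<exists>D. ((\<lambda>z. inverse (f z)) has_derivative D) (at z) \<and> (\<forall>c v. D (c *s v) = c * D v)"
    using assms(2)[OF z]
    by (intro exI[of _ "\<lambda>v. - (inverse (f z) * D v * inverse (f z))"] conjI
          Deriv.has_derivative_inverse) (simp_all add: mult_ac)
qed

lemma mv_holomorphic_on_diff:
  assumes "mv_holomorphic_on f U" "mv_holomorphic_on g U"
  shows "mv_holomorphic_on (\<lambda>z. f z - g z) U"
  using mv_holomorphic_on_add[OF assms(1)
      mv_holomorphic_on_mult[OF mv_holomorphic_on_const[of "-1"] assms(2)]] by simp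

lemma mv_holomorphic_on_divide:
  assumes "mv_holomorphic_on f U" "mv_holomorphic_on g U" "\<And>z. z \<in> U \<Longrightarrow> g z \<noteq> 0"
  shows "mv_holomorphic_on (\<lambda>z. f z / g z) U"
  using mv_holomorphic_on_mult[OF assms(1) mv_holomorphic_on_inverse[OF assms(2,3)]]
  by (simp add: field_simps)

lemma mv_holomorphic_on_sum:
  assumes "\<And>x. x \<in> A \<Longrightarrow> mv_holomorphic_on (f x) U"
  shows "mv_holomorphic_on (\<lambda>z. \<Sum>x\<in>A. f x z) U"
  using assms
  by (induction A rule: infinite_finite_induct)
     (auto intro: mv_holomorphic_on_const mv_holomorphic_on_add)

lemma mv_holomorphic_on_prod:
  assumes "\<And>x. x \<in> A \<Longrightarrow> mv_holomorphic_on (f x) U"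
  shows "mv_holomorphic_on (\<lambda>z. \<Prod>x\<in>A. f x z) U"
  using assms
  by (induction A rule: infinite_finite_induct)
     (auto intro: mv_holomorphic_on_const mv_holomorphic_on_mult)

section \<open>Complex lines and the identity theorem in several variables\<close>

lemma bounded_linear_vector_scalar_mult_left: "bounded_linear (\<lambda>c::complex. c *s v)"
  unfolding linear_conv_bounded_linear[symmetric]
  by (intro linearI) (auto simp: vec_eq_iff algebra_simps)

text \<open>On the complex line through \<open>b\<close> and \<open>w\<close> the function depends
  holomorphically on one parameter, which runs over a convex open set. It vanishes near parameter
  \<open>0\<close>, so one-variable continuation carries the zero to parameter \<open>1\<close>, the
  point \<open>w\<close>.\<close>

lemma mv_holomorphic_zero_on_ball:
  fixes f :: "complex ^ 'r \<Rightarrow> complex"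
  assumes hol: "mv_holomorphic_on f (ball a e)"
    and V: "open V" "b \<in> V" "b \<in> ball a e" "\<And>z. z \<in> V \<Longrightarrow> f z = 0"
    and w: "w \<in> ball a e"
  shows "f w = 0"
proof -
  define p where "p = (\<lambda>c::complex. b + c *s (w - b))"
  define S where "S = p -` ball a e"
  have p_der: "(p has_derivative (\<lambda>c. c *s (w - b))) (at c)" for c
    unfolding p_def
    by (auto intro!: derivative_eq_intros
          bounded_linear_imp_has_derivative bounded_linear_vector_scalar_mult_left)
  have p_cont: "continuous_on UNIV p"
    using p_der by (meson continuous_at_imp_continuous_on has_derivative_continuous)
  \<comment> \<open>As the preimage of a translated ball under a linear map, the parameter set is
    convex, hence connected.\<close>
  have S_eq: "S = (\<lambda>c::complex. c *s (w - b)) -` ball (a - b) e"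
    unfolding S_def p_def by (auto simp: dist_norm algebra_simps)
  have "convex S"
    unfolding S_eq
    by (intro convex_linear_vimage bounded_linear.linear
          bounded_linear_vector_scalar_mult_left convex_ball)
  have "open S"
    unfolding S_def using p_cont open_vimage by blast
  have "open (S \<inter> p -` V)" "0 \<in> S \<inter> p -` V"
    using \<open>open S\<close> p_cont V open_vimage by (auto simp: S_def p_def)
  hence lim: "0 islimpt (S \<inter> p -` V)"
    by (intro interior_limit_point) (simp only: interior_open)
  have "(\<lambda>c. f (p c)) holomorphic_on S"
  proof (rule holomorphic_onI)
    fix c assume "c \<in> S"
    hence "p c \<in> ball a e" by (simp add: S_def)
    with hol obtain D where D: "(f has_derivative D) (at (p c))" "\<forall>c v. D (c *s v) = c * D v"
      unfolding mv_holomorphic_on_def by blast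
    have "((\<lambda>c. f (p c)) has_derivative (\<lambda>h. D (h *s (w - b)))) (at c)"
      by (rule has_derivative_compose[OF p_der D(1)])
    \<comment> \<open>Homogeneity over the complex numbers, the Cauchy-Riemann condition, turns the
      real derivative along the line into a complex one.\<close>
    moreover have "(\<lambda>h. D (h *s (w - b))) = (*) (D (w - b))"
      by (intro ext) (simp only: D(2)[rule_format] mult.commute)
    ultimately have "((\<lambda>c. f (p c)) has_field_derivative D (w - b)) (at c)"
      by (simp add: has_field_derivative_def)
    thus "(\<lambda>c. f (p c)) field_differentiable at c within S"
      using field_differentiable_at_within field_differentiable_def by blast
  qed
  moreover have "1 \<in> S" using w by (auto simp: S_def p_def)
  ultimately have "f (p 1) = 0"
    using analytic_continuation[of "\<lambda>c. f (p c)" S "S \<inter> p -` V" 0 1] lim V \<open>open S\<close>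
      \<open>convex S\<close> convex_connected by (auto simp: S_def p_def)
  thus ?thesis by (simp add: p_def)
qed

text \<open>The interior of the zero set is open, and closed relative to \<open>U\<close> because
  the previous lemma fills every ball in \<open>U\<close> that it meets; connectedness does the
  rest.\<close>

lemma mv_holomorphic_identity:
  fixes f :: "complex ^ 'r \<Rightarrow> complex"
  assumes hol: "mv_holomorphic_on f U" and U: "open U" "connected U"
    and V: "open V" "V \<subseteq> U" "V \<noteq> {}" "\<And>z. z \<in> V \<Longrightarrow> f z = 0"
    and z: "z \<in> U"
  shows "f z = 0"
proof -
  define T where "T = interior {z \<in> U. f z = 0}"
  have TU: "T \<subseteq> U" and T0: "\<And>z. z \<in> T \<Longrightarrow> f z = 0"
    unfolding T_def using interior_subset by auto
  have "V \<subseteq> T"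
    unfolding T_def using V by (intro interior_maximal) auto
  have clo: "a \<in> T" if a: "a \<in> U" "a \<in> closure T" for a
  proof -
    obtain e where e: "e > 0" "ball a e \<subseteq> U"
      using U a openE by blast
    then obtain b where b: "b \<in> T" "b \<in> ball a e"
      using a(2) closure_iff_nhds_not_empty[of a T]
      by (metis centre_in_ball closure_approachable dist_commute mem_ball)
    have "f w = 0" if "w \<in> ball a e" for w
      by (rule mv_holomorphic_zero_on_ball[of f a e T b])
         (use b T0 that hol e in \<open>auto simp: T_def intro: mv_holomorphic_on_subset\<close>)
    hence "ball a e \<subseteq> {z \<in> U. f z = 0}" using e by auto
    thus ?thesis
      unfolding T_def using e by (meson centre_in_ball interior_maximal open_ball subsetD)
  qed
  have "openin (top_of_set U) T"
    using TU U by (simp add: T_def openin_open_eq)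
  moreover have "closedin (top_of_set U) T"
    using clo TU by (simp add: closedin_closed_eq closure_closed closure_subset closedin_limpt)
       (metis closure_def UnCI mem_Collect_eq)
  ultimately have "T = U"
    using U(2) \<open>V \<subseteq> T\<close> \<open>V \<noteq> {}\<close> unfolding connected_clopen by blast
  thus ?thesis using z T0 by blast
qed

text \<open>If the nonzero set missed a neighbourhood, the identity theorem would spread the zeros
  over all of \<open>U\<close>.\<close>

lemma mv_holomorphic_nonzero_dense:
  fixes h :: "complex ^ 'r \<Rightarrow> complex"
  assumes "mv_holomorphic_on h U" "open U" "connected U" "\<exists>z\<in>U. h z \<noteq> 0"
  shows "U \<subseteq> closure {z \<in> U. h z \<noteq> 0}"
proof
  fix z assume z: "z \<in> U"
  show "z \<in> closure {z \<in> U. h z \<noteq> 0}"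
  proof (rule ccontr)
    assume *: "z \<notin> closure {z \<in> U. h z \<noteq> 0}"
    define V where "V = U - closure {z \<in> U. h z \<noteq> 0}"
    have "open V" "V \<subseteq> U" "V \<noteq> {}" using assms * z by (auto simp: V_def)
    moreover have "h w = 0" if "w \<in> V" for w
      using that closure_subset[of "{z \<in> U. h z \<noteq> 0}"] by (auto simp: V_def)
    ultimately have "h w = 0" if "w \<in> U" for w
      using mv_holomorphic_identity[OF assms(1-3), of V w] that by blast
    thus False using assms(4) by blast
  qed
qed

section \<open>Density arguments and uniqueness of meromorphic continuations\<close>

lemma continuous_on_closure_zero:
  fixes f :: "'a::topological_space \<Rightarrow> 'b::t1_space"
  assumes "continuous_on U f" "open U" "z \<in> U" "z \<in> closure {w \<in> U. f w = c}"
  shows "f z = c"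
proof (rule ccontr)
  assume "f z \<noteq> c"
  define V where "V = f -` (- {c}) \<inter> U"
  have "open V"
    unfolding V_def using assms by (simp add: continuous_on_open_vimage open_delete Compl_eq_Diff_UNIV)
  moreover have "z \<in> V" using \<open>f z \<noteq> c\<close> assms by (simp add: V_def)
  ultimately have "V \<inter> {w \<in> U. f w = c} \<noteq> {}"
    using assms(4) open_Int_closure_eq_empty by (metis IntI empty_iff)
  thus False by (auto simp: V_def)
qed

text \<open>A small open set first meets \<open>W\<close> in an open set, which then meets
  \<open>A\<close>. Without openness of \<open>W\<close>, two dense sets could be disjoint.\<close>

lemma closure_Int_open_dense:
  assumes "open V" "V \<subseteq> closure A" "open W" "V \<subseteq> closure W"
  shows "V \<subseteq> closure (A \<inter> W)"
proof
  fix z assume z: "z \<in> V"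
  show "z \<in> closure (A \<inter> W)"
  proof (rule ccontr)
    assume *: "z \<notin> closure (A \<inter> W)"
    define T where "T = V - closure (A \<inter> W)"
    have T: "open T" "z \<in> T" using assms * z by (auto simp: T_def)
    have "T \<inter> W \<noteq> {}"
      using T assms(4) open_Int_closure_eq_empty[of T W] z by blast
    moreover have "open (T \<inter> W)" using T assms by auto
    ultimately have "T \<inter> W \<inter> A \<noteq> {}"
      using open_Int_closure_eq_empty[of "T \<inter> W" A] assms(2) by (auto simp: T_def)
    thus False using closure_subset[of "A \<inter> W"] by (auto simp: T_def)
  qed
qed

text \<open>Local quotients do not prescribe \<open>F\<close> where their denominators vanish. Hence
  the relation \<open>F * H = N\<close> is first spread as a statement about dense sets; the removal
  of singularities then turns density into equality wherever \<open>H\<close> is nonzero.\<close>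

lemma mv_meromorphic_unique:
  fixes F N H :: "complex ^ 'r \<Rightarrow> complex"
  assumes F: "mv_meromorphic_on F UNIV" "mv_removed_singularities F"
    and N: "mv_holomorphic_on N UNIV" and H: "mv_holomorphic_on H UNIV"
    and V: "open V" "V \<noteq> {}" "\<And>z. z \<in> V \<Longrightarrow> F z * H z = N z"
    and z: "H z \<noteq> 0"
  shows "F z = N z / H z"
proof -
  define P where "P = {w. F w * H w = N w}"
  \<comment> \<open>The set where \<open>P\<close> is locally dense turns out to be open and closed.
    \<open>P\<close> itself may miss points at which a local denominator vanishes.\<close>
  define S where "S = interior (closure P)"
  have "a \<in> S" if a: "a \<in> closure S" for a
  proof -
    obtain U g h where U: "open U" "connected U" "a \<in> U" and g: "mv_holomorphic_on g U"
      and h: "mv_holomorphic_on h U" "\<exists>z\<in>U. h z \<noteq> 0"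
      and eq: "\<And>z. z \<in> U \<Longrightarrow> h z \<noteq> 0 \<Longrightarrow> F z = g z / h z"
      using F(1) unfolding mv_meromorphic_on_def by (metis UNIV_I)
    define R where "R = {z \<in> U. h z \<noteq> 0}"
    have UR: "U \<subseteq> closure R"
      unfolding R_def by (rule mv_holomorphic_nonzero_dense[OF h(1) U(1,2) h(2)])
    have "open R"
    proof -
      have "R = h -` (- {0}) \<inter> U" by (auto simp: R_def)
      moreover have "open (h -` (- {0}) \<inter> U)"
        using mv_holomorphic_on_imp_continuous_on[OF h(1)] U(1)
        by (simp add: continuous_on_open_vimage open_delete Compl_eq_Diff_UNIV)
      ultimately show ?thesis by simp
    qed
    \<comment> \<open>Clearing both denominators gives a holomorphic function whose zeros, where
      \<open>h\<close> does not vanish, are exactly the points of \<open>P\<close>.\<close>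
    define d where "d = (\<lambda>z. g z * H z - N z * h z)"
    have d: "mv_holomorphic_on d U"
      unfolding d_def
      by (intro mv_holomorphic_on_diff mv_holomorphic_on_mult g h mv_holomorphic_on_subset[OF N]
            mv_holomorphic_on_subset[OF H]) auto
    have d_P: "d w = 0 \<longleftrightarrow> w \<in> P" if "w \<in> R" for w
    proof -
      have "g w = F w * h w" "h w \<noteq> 0" using that eq[of w] by (auto simp: R_def)
      hence "d w = h w * (F w * H w - N w)" by (simp add: d_def algebra_simps)
      thus ?thesis using \<open>h w \<noteq> 0\<close> by (simp add: P_def)
    qed
    have "open S" by (simp add: S_def)
    have "S \<inter> U \<noteq> {}"
      using a U open_Int_closure_eq_empty[of U S] by blast
    have "S \<inter> U \<subseteq> closure (P \<inter> R)"
      by (rule closure_Int_open_dense)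
         (use \<open>open S\<close> \<open>open R\<close> U UR interior_subset[of "closure P"] in \<open>auto simp: S_def\<close>)
    also have "\<dots> \<subseteq> closure {w \<in> U. d w = 0}"
      using d_P by (intro closure_mono) (auto simp: R_def)
    finally have "d w = 0" if "w \<in> S \<inter> U" for w
      using that continuous_on_closure_zero[OF mv_holomorphic_on_imp_continuous_on[OF d] U(1), of w 0]
      by blast
    hence d0: "d w = 0" if "w \<in> U" for w
      using mv_holomorphic_identity[OF d U(1,2), of "S \<inter> U"] \<open>open S\<close> U(1) \<open>S \<inter> U \<noteq> {}\<close> that
      by blast
    have "R \<subseteq> P" using d0 d_P by (auto simp: R_def)
    hence "U \<subseteq> closure P" using UR closure_mono by blast
    thus ?thesis unfolding S_def using U interior_maximal by blast
  qed
  hence "closed S" using closure_subset_eq[of S] by blast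
  moreover have "open S" by (simp add: S_def)
  moreover have "V \<subseteq> S"
    unfolding S_def using V closure_subset[of P] by (intro interior_maximal) (auto simp: P_def)
  ultimately have "S = UNIV" using clopen[of S] V(2) by blast
  hence dense: "closure P = UNIV" unfolding S_def using interior_subset by blast
  define W where "W = {z. H z \<noteq> 0}"
  have "open W"
    unfolding W_def
    using mv_holomorphic_on_imp_continuous_on[OF H] by (intro open_Collect_neq) auto
  have "W \<subseteq> closure (P \<inter> W)"
    using \<open>open W\<close> dense by (intro closure_Int_open_dense) (auto intro: closure_subset[THEN subsetD])
  also have "\<dots> \<subseteq> closure {z \<in> W. F z = N z / H z}"
    by (intro closure_mono) (auto simp: P_def W_def field_simps)
  finally have "W \<subseteq> closure {z \<in> W. F z = N z / H z}" .
  moreover have "mv_holomorphic_on (\<lambda>z. N z / H z) W"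
    by (intro mv_holomorphic_on_divide mv_holomorphic_on_subset[OF N]
          mv_holomorphic_on_subset[OF H]) (auto simp: W_def)
  ultimately have "F z = N z / H z" if "z \<in> W" for z
    using F(2) \<open>open W\<close> that unfolding mv_removed_singularities_def by blast
  thus ?thesis using z by (simp add: W_def)
qed

text \<open>
  The limit of the quotient along the set where the denominator does not vanish is the value of
  any holomorphic extension, so that it removes all removable singularities at once.
\<close>

lemma mv_meromorphic_removed_singularities_exists:
  fixes N H :: "complex ^ 'r \<Rightarrow> complex"
  assumes N: "mv_holomorphic_on N UNIV" and H: "mv_holomorphic_on H UNIV" "\<exists>z. H z \<noteq> 0"
  shows "\<exists>F. mv_meromorphic_on F UNIV \<and> mv_removed_singularities F \<and>
           (\<forall>z. H z \<noteq> 0 \<longrightarrow> F z = N z / H z)"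
proof -
  define W where "W = {z. H z \<noteq> 0}"
  \<comment> \<open>\<open>Lim\<close> is an unspecified value where no limit exists. Wherever a
    holomorphic function agrees with \<open>F\<close> on a dense set, the limit exists, so the
    condition on removed singularities never meets such a value.\<close>
  define F where "F = (\<lambda>z. Lim (at z within W) (\<lambda>z. N z / H z))"
  have "open W"
    unfolding W_def
    using mv_holomorphic_on_imp_continuous_on[OF H(1)] by (intro open_Collect_neq) auto
  have W: "closure W = UNIV"
    using mv_holomorphic_nonzero_dense[OF H(1)] H(2) by (auto simp: W_def)
  \<comment> \<open>Density of \<open>W\<close> makes every point a limit point of it, so the limits
    defining \<open>F\<close> are unique.\<close>
  have nontriv: "at z within W \<noteq> bot" for z
  proof -
    have "z islimpt W"
    proof (cases "z \<in> W")
      case True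
      thus ?thesis using \<open>open W\<close> by (intro interior_limit_point) (simp only: interior_open)
    next
      case False
      thus ?thesis using W by (auto simp: closure_def)
    qed
    thus ?thesis by (simp add: trivial_limit_within)
  qed
  have cont: "continuous_on W (\<lambda>z. N z / H z)"
    by (intro mv_holomorphic_on_imp_continuous_on mv_holomorphic_on_divide
          mv_holomorphic_on_subset[OF N] mv_holomorphic_on_subset[OF H(1)]) (auto simp: W_def)
  have F_eq: "F z = N z / H z" if "z \<in> W" for z
    unfolding F_def using cont nontriv that by (intro tendsto_Lim) (auto simp: continuous_on_def)
  have "mv_meromorphic_on F UNIV"
    unfolding mv_meromorphic_on_def
  proof
    fix a
    show "\<exists>U g h. open U \<and> connected U \<and> a \<in> U \<and> mv_holomorphic_on g U \<and> mv_holomorphic_on h U \<and>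
            (\<exists>z\<in>U. h z \<noteq> 0) \<and> (\<forall>z\<in>U. h z \<noteq> 0 \<longrightarrow> F z = g z / h z)"
      by (rule exI[of _ UNIV], rule exI[of _ N], rule exI[of _ H])
         (use N H F_eq in \<open>simp add: W_def convex_connected\<close>)
  qed
  moreover have "mv_removed_singularities F"
    unfolding mv_removed_singularities_def
  proof (intro allI impI ballI, elim conjE)
    fix U G z
    assume U: "open U" "mv_holomorphic_on G U" "U \<subseteq> closure {z \<in> U. F z = G z}" "z \<in> U"
    note G = mv_holomorphic_on_imp_continuous_on[OF U(2)]
    \<comment> \<open>Inside \<open>W\<close> both sides are continuous, so dense agreement is full
      agreement; the remaining points are then reached by the limit within \<open>W\<close>.\<close>
    have G_eq: "G w = N w / H w" if w: "w \<in> U \<inter> W" for w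
    proof -
      have "w \<in> closure ({z \<in> U. F z = G z} \<inter> W)"
        using closure_Int_open_dense[OF U(1,3) \<open>open W\<close>] W w by blast
      also have "\<dots> \<subseteq> closure {z \<in> U \<inter> W. G z - N z / H z = 0}"
        using F_eq by (intro closure_mono) auto
      finally have "G w - N w / H w = 0"
        using w U(1) \<open>open W\<close> G cont
        by (intro continuous_on_closure_zero[of "U \<inter> W"])
           (auto intro!: continuous_on_diff intro: continuous_on_subset)
      thus ?thesis by simp
    qed
    have "(G \<longlongrightarrow> G z) (at z within W)"
      using G U(1,4) by (metis at_within_open continuous_on_def tendsto_within_subset subset_UNIV)
    moreover have "eventually (\<lambda>w. G w = N w / H w) (at z within W)"
      using G_eq U(1,4) by (auto simp: eventually_at_topological)
    ultimately have "((\<lambda>w. N w / H w) \<longlongrightarrow> G z) (at z within W)"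
      by (rule Lim_transform_eventually)
    thus "F z = G z"
      unfolding F_def using nontriv by (intro tendsto_Lim)
  qed
  ultimately show ?thesis using F_eq by (auto simp: W_def)
qed

text \<open>Each inner limit is the value of \<open>F\<close> with the listed coordinates already
  replaced by those of \<open>a\<close>, so the induction runs over all base points
  \<open>s\<close>. Openness of the factors keeps nearby vectors inside the domain of
  continuity.\<close>

lemma iterated_limit_of_continuous:
  fixes a :: "complex ^ 'r" and A :: "'r \<Rightarrow> complex set"
  assumes A: "\<And>i. open (A i)" "\<And>i. a $ i \<in> A i"
    and F: "continuous_on {s. \<forall>i. s $ i \<in> A i} F"
    and s: "\<And>i. i \<notin> set is \<Longrightarrow> s $ i \<in> A i"
  shows "iterated_limit F a is s (F (\<chi> i. if i \<in> set is then a $ i else s $ i))"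
  using s
proof (induction "is" arbitrary: s)
  case Nil
  have "(\<chi> i. (s $ i)) = s" by (simp add: vec_eq_iff)
  thus ?case by simp
next
  case (Cons i "is")
  define u where "u = (\<lambda>z. \<chi> j. if j = i then z else s $ j)"
  define v where "v = (\<lambda>z. \<chi> j. if j \<in> set is then a $ j else u z $ j)"
  define G where "G = (\<lambda>z. F (v z))"
  have v_a: "v (a $ i) = (\<chi> j. if j \<in> set (i # is) then a $ j else s $ j)"
    by (simp add: v_def u_def vec_eq_iff)
  have "eventually (\<lambda>z. z \<in> A i) (at (a $ i))"
    using A by (intro eventually_at_in_open') auto
  hence "\<forall>\<^sub>F z in at (a $ i). iterated_limit F a is (u z) (G z)"
  proof eventually_elim
    case (elim z)
    thus ?case
      unfolding G_def v_def using Cons.prems by (intro Cons.IH) (auto simp: u_def)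
  qed
  moreover have "(G \<longlongrightarrow> F (v (a $ i))) (at (a $ i))"
  proof -
    have "open {s. \<forall>i. s $ i \<in> A i}"
    proof -
      have "{s. \<forall>i. s $ i \<in> A i} = (\<Inter>i. (\<lambda>s. s $ i) -` A i)" by auto
      thus ?thesis using A by (auto intro!: open_INT open_vimage_vec_nth)
    qed
    moreover have "v (a $ i) \<in> {s. \<forall>i. s $ i \<in> A i}"
      using A Cons.prems by (auto simp: v_a)
    ultimately have "isCont F (v (a $ i))"
      using F continuous_on_eq_continuous_at by blast
    moreover have "isCont v (a $ i)"
      unfolding v_def u_def isCont_def
    proof (rule vec_tendstoI)
      fix j
      show "((\<lambda>z. (\<chi> j. if j \<in> set is then a $ j else (\<chi> j. if j = i then z else s $ j) $ j) $ j)
              \<longlongrightarrow> (\<chi> j. if j \<in> set is then a $ j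
                      else (\<chi> j. if j = i then a $ i else s $ j) $ j) $ j) (at (a $ i))"
        by (cases "j \<in> set is"; cases "j = i") simp_all
    qed
    ultimately show ?thesis
      unfolding G_def isCont_def by (rule isCont_tendsto_compose[unfolded isCont_def])
  qed
  ultimately show ?case
    unfolding iterated_limit.simps v_a u_def by blast
qed

subsection \<open>Bernoulli numbers\<close>

text \<open>Its coefficients are \<open>B_n / n!\<close>.\<close>

definition bernoulli_fps :: "complex fps" where
  "bernoulli_fps = fps_X / (fps_exp 1 - 1)"

lemma subdegree_fps_exp_minus_1: "subdegree (fps_exp 1 - 1 :: complex fps) = 1"
  by (rule subdegreeI) auto

text \<open>\<open>fps_exp 1 - 1\<close> has subdegree 1, so the division cancels one factor
  \<open>X\<close> and leaves the inverse of a series with constant term 1.\<close>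

lemma bernoulli_fps_eq_inverse: "bernoulli_fps = inverse (fps_shift 1 (fps_exp 1 - 1))"
proof -
  have "fps_shift 1 (fps_X * f) = f" for f :: "complex fps"
    by (simp add: fps_eq_iff)
  thus ?thesis
    by (simp add: bernoulli_fps_def fps_divide_def subdegree_fps_exp_minus_1
        del: subdegree_minus_commute)
qed

lemma bernoulli_fps_0 [simp]: "fps_nth bernoulli_fps 0 = 1"
  by (simp add: bernoulli_fps_eq_inverse)

lemma exp_ne_1:
  fixes z :: complex
  assumes "z \<noteq> 0" "norm z < 2 * pi"
  shows "exp z \<noteq> 1"
proof
  assume "exp z = 1"
  then obtain n :: int where n: "Re z = 0" "Im z = of_int (2 * n) * pi"
    by (auto simp: exp_eq_1)
  have "\<bar>Im z\<bar> < 2 * pi" using assms abs_Im_le_cmod[of z] by linarith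
  hence "\<bar>of_int n\<bar> * (2 * pi) < 1 * (2 * pi)" using n by (simp add: abs_mult mult_ac)
  hence "\<bar>real_of_int n\<bar> < 1" by (subst (asm) mult_less_cancel_right_pos) auto
  hence "n = 0" by linarith
  thus False using n assms by (simp add: complex_eq_iff)
qed

text \<open>The function \<open>(exp z - 1) / z\<close>, completed by 1 at 0, is entire and has no
  zero of modulus below \<open>2 * pi\<close>, so its reciprocal expands in that whole disc.\<close>

lemma
  shows bernoulli_fps_sums:
      "\<And>z. norm z < 2 * pi \<Longrightarrow>
        (\<lambda>n. fps_nth bernoulli_fps n * z ^ n) sums (if z = 0 then 1 else z / (exp z - 1))"
    and bernoulli_fps_conv_radius: "fps_conv_radius bernoulli_fps \<ge> 2 * pi"
proof -
  define G :: "complex fps" where "G = fps_shift 1 (fps_exp 1 - 1)"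
  define f where "f = (\<lambda>z. inverse (eval_fps G z))"
  have rad: "fps_conv_radius (fps_exp 1 - 1 :: complex fps) = \<infinity>"
    using fps_conv_radius_diff[of "fps_exp 1 :: complex fps" 1] by simp
  have G: "eval_fps G z = (if z = 0 then 1 else (exp z - 1) / z)" for z
    unfolding G_def using rad
    by (subst eval_fps_shift)
       (simp_all add: subdegree_fps_exp_minus_1 eval_fps_diff del: subdegree_minus_commute)
  have radG: "fps_conv_radius G = \<infinity>"
    unfolding G_def using rad by (subst fps_conv_radius_shift) simp
  have "eval_fps G has_fps_expansion G"
    using radG by (intro eval_fps_has_fps_expansion) simp
  hence exp: "f has_fps_expansion bernoulli_fps"
    unfolding f_def bernoulli_fps_eq_inverse G_def[symmetric]
    by (intro has_fps_expansion_inverse) (auto simp: G_def)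
  have hol: "f holomorphic_on eball 0 (2 * pi)"
    unfolding f_def using radG exp_ne_1 by (intro holomorphic_intros) (auto simp: G split: if_splits)
  show "fps_conv_radius bernoulli_fps \<ge> 2 * pi"
    using holomorphic_on_imp_fps_conv_radius_ge[OF exp hol] by simp
  fix z :: complex assume "norm z < 2 * pi"
  thus "(\<lambda>n. fps_nth bernoulli_fps n * z ^ n) sums (if z = 0 then 1 else z / (exp z - 1))"
    using has_fps_expansion_imp_sums_complex[OF exp hol, of z] by (simp add: f_def G split: if_splits)
qed

text \<open>The point 1 lies inside the disc of convergence. This is what allows Riemann's integral
  to be cut at 1 and expanded termwise on the unit interval.\<close>

lemma summable_norm_bernoulli_fps: "summable (\<lambda>n. norm (fps_nth bernoulli_fps n))"
proof -
  have "ereal (norm (1::complex)) < ereal (2 * pi)" using pi_gt3 by simp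
  also note bernoulli_fps_conv_radius
  finally show ?thesis using norm_summable_fps[of 1 bernoulli_fps] by simp
qed

subsection \<open>The entire ingredients of the continuation\<close>

text \<open>Locally uniform limits of holomorphic functions are holomorphic. The bound is asked only
  eventually because, on a given disc, the first few summands may escape it.\<close>

lemma holomorphic_on_suminf_M_test:
  fixes f :: "nat \<Rightarrow> complex \<Rightarrow> complex"
  assumes hol: "\<And>n. f n holomorphic_on UNIV"
    and bound: "\<And>r. \<exists>M. summable M \<and> (\<forall>\<^sub>F n in sequentially. \<forall>s\<in>cball 0 r. norm (f n s) \<le> M n)"
  shows "(\<lambda>s. \<Sum>n. f n s) holomorphic_on UNIV"
proof (rule holomorphic_uniform_sequence)
  show "(\<lambda>s. \<Sum>n<N. f n s) holomorphic_on UNIV" for N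
    by (intro holomorphic_on_sum hol)
  fix x :: complex
  obtain M where M: "summable M"
    "\<forall>\<^sub>F n in sequentially. \<forall>s\<in>cball 0 (norm x + 1). norm (f n s) \<le> M n"
    using bound by blast
  have "cball x 1 \<subseteq> cball 0 (norm x + 1)"
    by (simp add: cball_subset_cball_iff)
  hence "uniform_limit (cball x 1) (\<lambda>N s. \<Sum>n<N. f n s) (\<lambda>s. \<Sum>n. f n s) sequentially"
    using M by (intro Weierstrass_m_test_ev) (auto elim!: eventually_mono)
  thus "\<exists>d>0. cball x d \<subseteq> UNIV \<and>
          uniform_limit (cball x d) (\<lambda>N s. \<Sum>n<N. f n s) (\<lambda>s. \<Sum>n. f n s) sequentially"
    by (intro exI[of _ 1]) auto
qed auto

text \<open>This is the entire function extending \<open>rGamma s / (s + m)\<close>.\<close>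

definition rGamma_quot :: "nat \<Rightarrow> complex \<Rightarrow> complex" where
  "rGamma_quot m s = pochhammer s m * rGamma (s + of_nat m + 1)"

lemma rGamma_quot_mult: "(s + of_nat m) * rGamma_quot m s = rGamma s"
  using pochhammer_rGamma[of s "Suc m"]
  by (simp add: rGamma_quot_def pochhammer_Suc algebra_simps)

lemma rGamma_quot_holomorphic: "rGamma_quot m holomorphic_on UNIV"
  unfolding rGamma_quot_def[abs_def] pochhammer_prod by (intro holomorphic_intros)

text \<open>\<open>rGamma\<close> vanishes at \<open>- n\<close>, and the linear factor in
  \<open>rGamma_quot_mult\<close> is nonzero there unless \<open>m = n\<close>, where the Pochhammer
  product gives the value.\<close>

lemma rGamma_quot_minus_of_nat:
  "rGamma_quot m (- of_nat n) = (if m = n then (- 1) ^ n * fact n else 0)"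
proof (cases "m = n")
  case True
  thus ?thesis by (simp add: rGamma_quot_def pochhammer_minus pochhammer_fact[symmetric])
next
  case False
  have "rGamma (- of_nat n :: complex) = 0" by (simp add: rGamma_eq_zero_iff)
  moreover have "- of_nat n + of_nat m \<noteq> (0 :: complex)" using False by simp
  ultimately show ?thesis using False rGamma_quot_mult[of "- of_nat n" m] by simp
qed

text \<open>This is \<open>1 / Gamma s\<close> times the polar sum in Riemann's representation, with
  \<open>k = m + 1\<close>. The term \<open>k = 0\<close>, which carries the pole at 1, is left for
  \<open>reg_zeta\<close>.\<close>

definition zeta_series :: "complex \<Rightarrow> complex" where
  "zeta_series s = (\<Sum>m. fps_nth bernoulli_fps (Suc m) * rGamma_quot m s)"

lemma zeta_series_holomorphic: "zeta_series holomorphic_on UNIV"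
proof -
  have bound: "\<exists>M. summable M \<and> (\<forall>\<^sub>F n in sequentially. \<forall>s\<in>cball 0 r.
      norm (fps_nth bernoulli_fps (Suc n) * rGamma_quot n s) \<le> M n)" for r
  proof -
    have "compact (rGamma ` cball 0 r :: complex set)"
      by (intro compact_continuous_image continuous_intros) auto
    then obtain C where C: "\<And>s::complex. s \<in> cball 0 r \<Longrightarrow> norm (rGamma s) \<le> C"
      using compact_imp_bounded bounded_iff by (metis imageI)
    \<comment> \<open>For these \<open>n\<close> the disc stays at distance at least 1 from
      \<open>- n\<close>, so dividing \<open>rGamma s\<close> by \<open>s + n\<close> cannot enlarge
      it.\<close>
    have "norm (fps_nth bernoulli_fps (Suc n) * rGamma_quot n s) \<le>
            norm (fps_nth bernoulli_fps (Suc n)) * C"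
      if n: "real n \<ge> r + 1" and s: "s \<in> cball 0 r" for n s
    proof -
      have "1 \<le> norm (s + of_nat n)"
        using n s norm_diff_ineq[of "of_nat n" s] by (simp add: add.commute)
      hence "norm (rGamma_quot n s) * 1 \<le> norm (rGamma_quot n s) * norm (s + of_nat n)"
        by (intro mult_left_mono) auto
      also have "\<dots> = norm (rGamma s)"
        by (subst rGamma_quot_mult[of s n, symmetric]) (simp add: norm_mult mult.commute)
      finally have "norm (rGamma_quot n s) \<le> C" using C[OF s] by simp
      thus ?thesis by (simp add: norm_mult mult_left_mono)
    qed
    moreover have "\<forall>\<^sub>F n in sequentially. r + 1 \<le> real n"
      using filterlim_real_sequentially by (simp add: filterlim_at_top)
    ultimately have "\<forall>\<^sub>F n in sequentially. \<forall>s\<in>cball 0 r.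
        norm (fps_nth bernoulli_fps (Suc n) * rGamma_quot n s) \<le>
          norm (fps_nth bernoulli_fps (Suc n)) * C"
      by (auto elim!: eventually_mono)
    moreover have "summable (\<lambda>n. norm (fps_nth bernoulli_fps (Suc n)) * C)"
      by (intro summable_mult2 summable_norm_bernoulli_fps[THEN summable_Suc_iff[THEN iffD2]])
    ultimately show ?thesis by blast
  qed
  have hol: "(\<lambda>s. fps_nth bernoulli_fps (Suc n) * rGamma_quot n s) holomorphic_on UNIV" for n
    by (intro holomorphic_intros rGamma_quot_holomorphic)
  show "zeta_series holomorphic_on UNIV"
    unfolding zeta_series_def[abs_def] by (rule holomorphic_on_suminf_M_test[OF hol bound])
qed

lemma zeta_series_minus_of_nat:
  "zeta_series (- of_nat n) = fps_nth bernoulli_fps (Suc n) * ((- 1) ^ n * fact n)"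
proof -
  have "(\<lambda>m. fps_nth bernoulli_fps (Suc m) * rGamma_quot m (- of_nat n)) sums
          (\<Sum>m\<in>{n}. fps_nth bernoulli_fps (Suc m) * rGamma_quot m (- of_nat n))"
    by (rule sums_finite) (auto simp: rGamma_quot_minus_of_nat)
  thus ?thesis by (simp add: zeta_series_def sums_iff rGamma_quot_minus_of_nat)
qed

section \<open>The integral over the half-line from 1\<close>

definition bose_kernel :: "complex \<Rightarrow> real \<Rightarrow> complex" where
  "bose_kernel s x = of_real x powr (s - 1) / of_real (exp x - 1)"

lemma bose_kernel_continuous:
  assumes "A \<subseteq> {0<..}"
  shows "continuous_on A (bose_kernel s)"
  unfolding bose_kernel_def[abs_def] using assms
  by (intro continuous_intros) auto

text \<open>Cutting the half-line into unit intervals reduces holomorphy to parameter integrals over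
  compact intervals and the M-test.\<close>

definition zeta_tail :: "complex \<Rightarrow> complex" where
  "zeta_tail s = (\<Sum>n. integral {real n + 1..real n + 2} (bose_kernel s))"

text \<open>All terms of the exponential series are nonnegative, so those of index \<open>0\<close>
  and \<open>k\<close> bound the sum from below; \<open>k > 0\<close> keeps the two apart.\<close>

lemma exp_minus_1_ge:
  assumes "(x::real) \<ge> 0" "k > 0"
  shows "exp x - 1 \<ge> x ^ k / fact k"
proof -
  have "(\<lambda>n. x ^ n /\<^sub>R fact n) sums exp x" by (rule exp_converges)
  moreover have "(\<Sum>n\<in>{0, k}. x ^ n /\<^sub>R fact n) \<le> (\<Sum>n. x ^ n /\<^sub>R fact n)"
    by (rule sum_le_suminf) (use assms summable_exp[of x] in \<open>auto\<close>)
  ultimately have "(\<Sum>n\<in>{0, k}. x ^ n /\<^sub>R fact n) \<le> exp x"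
    by (simp only: sums_iff)
  thus ?thesis using assms by (simp add: field_simps)
qed

lemma zeta_tail_holomorphic: "zeta_tail holomorphic_on UNIV"
proof -
  have bound: "\<exists>M. summable M \<and> (\<forall>\<^sub>F n in sequentially. \<forall>s\<in>cball 0 r.
      norm (integral {real n + 1..real n + 2} (bose_kernel s)) \<le> M n)" for r
  proof -
    \<comment> \<open>On the disc \<open>Re s - 1\<close> is at most \<open>N\<close>. Bounding
      \<open>exp x - 1\<close> below by the power \<open>N + 2\<close> therefore leaves the summable
      decay \<open>1 / x ^ 2\<close>.\<close>
    define N where "N = nat \<lceil>r\<rceil>"
    have "norm (integral {real n + 1..real n + 2} (bose_kernel s)) \<le>
            fact (N + 2) * (1 / (real n + 1) ^ 2)"
      if s: "s \<in> cball 0 r" for n s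
    proof -
      have "norm (bose_kernel s x) \<le> fact (N + 2) * (1 / (real n + 1) ^ 2)"
        if x: "x \<in> {real n + 1..real n + 2}" for x
      proof -
        have x1: "x \<ge> 1" using x by simp
        have "Re s - 1 \<le> real N"
          using s complex_Re_le_cmod[of s] by (simp add: N_def) linarith
        have "norm (bose_kernel s x) = x powr (Re s - 1) / (exp x - 1)"
          using x1 by (simp add: bose_kernel_def norm_divide norm_powr_real_powr
            flip: of_real_diff)
        also have "\<dots> \<le> x ^ N / (exp x - 1)"
          using x1 \<open>Re s - 1 \<le> real N\<close>
          by (intro divide_right_mono) (auto simp: powr_mono powr_realpow[symmetric])
        also have "\<dots> \<le> x ^ N / (x ^ (N + 2) / fact (N + 2))"
          using x1 exp_minus_1_ge[of x "N + 2"]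
          by (intro divide_left_mono mult_pos_pos divide_pos_pos) auto
        also have "\<dots> = fact (N + 2) * (1 / x ^ 2)"
          using x1 by (simp add: power_add power2_eq_square field_simps del: fact_Suc)
        also have "\<dots> \<le> fact (N + 2) * (1 / (real n + 1) ^ 2)"
          using x by (intro mult_left_mono divide_left_mono power_mono) (auto simp del: fact_Suc)
        finally show ?thesis .
      qed
      moreover have "continuous_on {real n + 1..real n + 2} (bose_kernel s)"
        by (rule bose_kernel_continuous) auto
      ultimately show ?thesis
        using integral_bound[of "real n + 1" "real n + 2" "bose_kernel s"
            "fact (N + 2) * (1 / (real n + 1) ^ 2)"] by simp
    qed
    moreover have "summable (\<lambda>n. fact (N + 2) * (1 / (real n + 1) ^ 2))"
    proof (rule summable_mult)
      have "summable (\<lambda>n. inverse (real n ^ 2))" by (rule inverse_power_summable) simp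
      hence "summable (\<lambda>n. inverse (real (Suc n) ^ 2))" by (rule summable_Suc_iff[THEN iffD2])
      thus "summable (\<lambda>n. 1 / (real n + 1) ^ 2)" by (simp add: inverse_eq_divide add.commute)
    qed
    ultimately show ?thesis by (intro exI conjI) (auto intro!: always_eventually)
  qed
  have hol: "(\<lambda>s. integral {real n + 1..real n + 2} (bose_kernel s)) holomorphic_on UNIV" for n
  proof -
    have "(\<lambda>s. integral (cbox (real n + 1) (real n + 2)) (bose_kernel s)) holomorphic_on UNIV"
    proof (rule leibniz_rule_holomorphic)
      fix s :: complex and x :: real assume x: "x \<in> cbox (real n + 1) (real n + 2)"
      show "((\<lambda>s. bose_kernel s x) has_field_derivative
              Ln (of_real x) * of_real x powr (s - 1) / of_real (exp x - 1)) (at s within UNIV)"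
      proof -
        have "((\<lambda>s. of_real x powr (s - 1)) has_field_derivative
                Ln (of_real x) * of_real x powr (s - 1) * 1) (at s)"
          using x by (intro DERIV_chain2[OF has_field_derivative_powr_right])
                     (auto intro!: derivative_eq_intros)
        thus ?thesis unfolding bose_kernel_def by (intro DERIV_cdivide) simp
      qed
    next
      fix s :: complex
      show "bose_kernel s integrable_on cbox (real n + 1) (real n + 2)"
        by (intro integrable_continuous bose_kernel_continuous) auto
    next
      show "continuous_on (UNIV \<times> cbox (real n + 1) (real n + 2))
              (\<lambda>(s, x). Ln (of_real x) * of_real x powr (s - 1) / of_real (exp x - 1))"
        unfolding case_prod_unfold
        by (intro continuous_intros) (auto simp: complex_nonpos_Reals_iff)
    qed auto
    thus ?thesis by simp
  qed
  show "zeta_tail holomorphic_on UNIV"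
    unfolding zeta_tail_def[abs_def] by (rule holomorphic_on_suminf_M_test[OF hol bound])
qed

subsection \<open>The Mellin transform of the kernel\<close>

text \<open>Substituting \<open>c * x\<close> for \<open>x\<close> in the Gamma integral produces
  \<open>c powr (s - 1)\<close> from the integrand and \<open>c\<close> from the measure.\<close>

lemma set_integral_Gamma_scaled:
  assumes s: "Re s > 0" and c: "c > 0"
  shows "(LINT x:{0<..}|lebesgue. of_real x powr (s - 1) / of_real (exp (c * x))) =
           Gamma s * of_real c powr (- s)"
proof -
  define f where "f = (\<lambda>x::real. indicat_real {0<..} x *\<^sub>R (of_real x powr (s - 1) / of_real (exp x) :: complex))"
  define g where "g = (\<lambda>x::real. indicat_real {0<..} x *\<^sub>R (of_real x powr (s - 1) / of_real (exp (c * x)) :: complex))"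
  have "integral\<^sup>L lebesgue f = Gamma s"
    using has_integral_unique[OF has_integral_set_lebesgue[OF absolutely_integrable_Gamma_integral'[OF s]]
        Gamma_integral_complex'[OF s]]
    by (simp add: f_def set_lebesgue_integral_def)
  moreover have "f (c * x) = of_real c powr (s - 1) * g x" for x
    using c by (auto simp: f_def g_def indicator_def powr_times_real zero_less_mult_iff)
  hence "integral\<^sup>L lebesgue f = of_real c * (of_real c powr (s - 1) * integral\<^sup>L lebesgue g)"
    using c by (subst lebesgue_integral_real_affine[where c = c and t = 0]) (auto simp: scaleR_conv_of_real)
  moreover have "of_real c * (of_real c powr (s - 1) * w) = of_real c powr s * w" for w :: complex
    using c by (simp add: powr_diff)
  ultimately have "of_real c powr s * integral\<^sup>L lebesgue g = Gamma s" by simp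
  thus ?thesis
    using c by (simp add: g_def set_lebesgue_integral_def powr_minus field_simps)
qed

text \<open>\<open>1 / (exp x - 1)\<close> is a geometric series in \<open>exp (- x)\<close>, and
  each term is a scaled Gamma integral. Termwise integration is justified because the integrals of
  the norms form a series that converges for \<open>Re s > 1\<close>.\<close>

lemma bose_kernel_integral:
  assumes s: "Re s > 1"
  shows "set_integrable lebesgue {0<..} (bose_kernel s)"
    and "(\<lambda>n. Gamma s * of_nat (Suc n) powr (- s)) sums (LINT x:{0<..}|lebesgue. bose_kernel s x)"
proof -
  define f :: "nat \<Rightarrow> real \<Rightarrow> complex" where
    "f = (\<lambda>n x. indicat_real {0<..} x *\<^sub>R (of_real x powr (s - 1) / of_real (exp (real (Suc n) * x))))"
  have int: "integrable lebesgue (f n)" for n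
    using absolutely_integrable_Gamma_integral[of s "real (Suc n)"] s
    by (simp add: f_def set_integrable_def)
  have f_sums: "(\<lambda>n. f n x) sums (indicat_real {0<..} x *\<^sub>R bose_kernel s x)"
    and f_norm: "summable (\<lambda>n. norm (f n x))" for x
  proof -
    have "(\<lambda>n. f n x) sums (indicat_real {0<..} x *\<^sub>R bose_kernel s x) \<and> summable (\<lambda>n. norm (f n x))"
    proof (cases "x > 0")
      case True
      define q where "q = exp (- x)"
      have q: "0 < q" "q < 1" using True by (auto simp: q_def)
      have eq: "f n x = of_real x powr (s - 1) * of_real q * of_real q ^ n" for n
        using True by (simp add: f_def q_def exp_minus divide_inverse exp_of_nat2_mult exp_add
            algebra_simps power_inverse)
      have "(\<lambda>n. (of_real q :: complex) ^ n) sums (1 / (1 - of_real q))"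
        using q by (intro geometric_sums) simp
      hence "(\<lambda>n. f n x) sums (of_real x powr (s - 1) * of_real q * (1 / (1 - of_real q)))"
        unfolding eq by (rule sums_mult)
      moreover have "of_real x powr (s - 1) * of_real q * (1 / (1 - of_real q)) = bose_kernel s x"
      proof -
        have e: "exp x > 1" using True by simp
        have "of_real q * (1 / (1 - of_real q)) = (of_real (q / (1 - q)) :: complex)" by simp
        also have "q / (1 - q) = 1 / (exp x - 1)"
          using e by (simp add: q_def exp_minus field_simps)
        finally show ?thesis by (simp only: bose_kernel_def mult.assoc) simp
      qed
      moreover have "summable (\<lambda>n. norm (f n x))"
        unfolding eq using q by (simp add: norm_mult norm_power summable_mult summable_geometric)
      ultimately show ?thesis using True by simp
    qed (simp add: f_def)
    thus "(\<lambda>n. f n x) sums (indicat_real {0<..} x *\<^sub>R bose_kernel s x)"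
      "summable (\<lambda>n. norm (f n x))" by auto
  qed
  \<comment> \<open>The norm of the integrand is the same integrand at the real exponent
    \<open>Re s\<close>, so the scaled Gamma integral applies again.\<close>
  have norm_int: "(\<integral>x. norm (f n x) \<partial>lebesgue) = norm (Gamma (of_real (Re s) :: complex)) * real (Suc n) powr (- Re s)" for n
  proof -
    have "of_real (norm (f n x)) = (indicat_real {0<..} x *\<^sub>R
        (of_real x powr (of_real (Re s) - 1) / of_real (exp (real (Suc n) * x))) :: complex)" for x
      by (auto simp: f_def indicator_def norm_divide norm_powr_real_powr powr_of_real[symmetric])
    hence "of_real (\<integral>x. norm (f n x) \<partial>lebesgue) =
        (LINT x:{0<..}|lebesgue. of_real x powr (of_real (Re s) - 1) / of_real (exp (real (Suc n) * x)) :: complex)"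
      by (simp add: set_lebesgue_integral_def flip: integral_complex_of_real)
    also have "\<dots> = Gamma (of_real (Re s)) * of_real (real (Suc n)) powr (- of_real (Re s))"
      using s by (intro set_integral_Gamma_scaled) auto
    finally have *: "of_real (\<integral>x. norm (f n x) \<partial>lebesgue) = \<dots>" .
    have "(\<integral>x. norm (f n x) \<partial>lebesgue) = norm (complex_of_real (\<integral>x. norm (f n x) \<partial>lebesgue))"
      by (simp add: integral_nonneg)
    also have "\<dots> = norm (Gamma (of_real (Re s) :: complex)) * real (Suc n) powr (- Re s)"
      unfolding * by (simp add: norm_mult norm_powr_real_powr del: of_nat_Suc)
    finally show ?thesis .
  qed
  have "summable (\<lambda>n. real (Suc n) powr (- Re s))"
    using s summable_real_powr_iff[of "- Re s"] by (intro summable_Suc_iff[THEN iffD2]) simp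
  hence int_norm: "summable (\<lambda>n. (\<integral>x. norm (f n x) \<partial>lebesgue))"
    unfolding norm_int by (rule summable_mult)
  have ae: "AE x in lebesgue. summable (\<lambda>n. norm (f n x))" using f_norm by simp
  have "integrable lebesgue (\<lambda>x. \<Sum>n. f n x)"
    "(\<lambda>n. integral\<^sup>L lebesgue (f n)) sums (\<integral>x. (\<Sum>n. f n x) \<partial>lebesgue)"
    by (rule integrable_suminf[OF int ae int_norm], rule sums_integral[OF int ae int_norm])
  moreover have "(\<lambda>x. \<Sum>n. f n x) = (\<lambda>x. indicat_real {0<..} x *\<^sub>R bose_kernel s x)"
    using f_sums by (simp add: sums_iff)
  moreover have "integral\<^sup>L lebesgue (f n) = Gamma s * of_nat (Suc n) powr (- s)" for n
    using set_integral_Gamma_scaled[of s "real (Suc n)"] s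
    by (simp add: f_def set_lebesgue_integral_def)
  ultimately show "set_integrable lebesgue {0<..} (bose_kernel s)"
    "(\<lambda>n. Gamma s * of_nat (Suc n) powr (- s)) sums (LINT x:{0<..}|lebesgue. bose_kernel s x)"
    by (simp_all add: set_integrable_def set_lebesgue_integral_def)
qed

text \<open>The unit pieces add up to integrals over \<open>{1..N + 1}\<close>, which tend to the
  integral over the half-line by integrability.\<close>

lemma bose_kernel_integral_tail:
  assumes "Re s > 1"
  shows "(LINT x:{1..}|lebesgue. bose_kernel s x) = zeta_tail s"
proof -
  have int: "set_integrable lebesgue {1..} (bose_kernel s)"
    by (rule set_integrable_subset[OF bose_kernel_integral(1)[OF assms]]) auto
  have sum: "(\<Sum>n<N. integral {real n + 1..real n + 2} (bose_kernel s)) =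
               integral {1..real N + 1} (bose_kernel s)" for N
  proof (induction N)
    case (Suc N)
    have "bose_kernel s integrable_on {1..real N + 2}"
      by (intro integrable_continuous_real bose_kernel_continuous) auto
    thus ?case
      using Suc Henstock_Kurzweil_Integration.integral_combine[of 1 "real N + 1" "real N + 2" "bose_kernel s"]
      by (simp add: add.commute)
  qed simp
  have "((\<lambda>b. LINT x:{1..b}|lebesgue. bose_kernel s x) \<longlongrightarrow>
          (LINT x:{1..}|lebesgue. bose_kernel s x)) at_top"
    by (rule tendsto_set_lebesgue_integral_at_top[OF _ int]) auto
  moreover have "filterlim (\<lambda>N. real N + 1) at_top sequentially"
    by (intro filterlim_tendsto_add_at_top filterlim_real_sequentially tendsto_const
        filterlim_at_top_mono[OF filterlim_real_sequentially] always_eventually) auto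
  ultimately have "(\<lambda>N. LINT x:{1..real N + 1}|lebesgue. bose_kernel s x) \<longlonglongrightarrow>
      (LINT x:{1..}|lebesgue. bose_kernel s x)"
    by (rule filterlim_compose)
  moreover have "(LINT x:{1..real N + 1}|lebesgue. bose_kernel s x) =
      (\<Sum>n<N. integral {real n + 1..real n + 2} (bose_kernel s))" for N
    unfolding sum
    by (intro set_lebesgue_integral_eq_integral set_integrable_subset[OF int]) auto
  ultimately have "(\<lambda>n. integral {real n + 1..real n + 2} (bose_kernel s)) sums
      (LINT x:{1..}|lebesgue. bose_kernel s x)"
    by (simp add: sums_def)
  thus ?thesis by (simp add: zeta_tail_def sums_iff)
qed

lemma has_integral_powr_unit_interval:
  assumes "Re w > 1"
  shows "((\<lambda>x. of_real x powr (w - 1)) has_integral (1 / w)) {0..1}"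
proof -
  have w: "w \<noteq> 0" using assms by auto
  have "((\<lambda>x. of_real x powr (w - 1)) has_integral
          ((of_real 1 powr w / w) - (of_real 0 powr w / w))) {0..1}"
  \<comment> \<open>The interior version asks for differentiability only away from 0, the branch
    point of \<open>powr\<close>; continuity suffices there.\<close>
  proof (rule fundamental_theorem_of_calculus_interior)
    show "continuous_on {0..1} (\<lambda>x. complex_of_real x powr w / w)"
      using assms w by (intro continuous_intros) auto
    fix x :: real assume x: "x \<in> {0<..<1}"
    have "((\<lambda>z. z powr w / w) has_field_derivative of_real x powr (w - 1)) (at (of_real x))"
      using x w by (auto intro!: derivative_eq_intros simp: complex_nonpos_Reals_iff)
    thus "((\<lambda>x. of_real x powr w / w) has_vector_derivative of_real x powr (w - 1)) (at x)"
      by (rule has_vector_derivative_real_field)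
  qed simp
  thus ?thesis by simp
qed

text \<open>The Bernoulli expansion of \<open>x / (exp x - 1)\<close> is multiplied by
  \<open>x powr (s - 2)\<close> and integrated termwise. For \<open>Re s > 2\<close> that factor is
  continuous and bounded by 1 on the unit interval, so convergence is uniform.\<close>

lemma bose_kernel_integral_head:
  assumes s: "Re s > 2"
  shows "(\<lambda>k. fps_nth bernoulli_fps k / (s - 1 + of_nat k)) sums
           (LINT x:{0<..<1}|lebesgue. bose_kernel s x)"
proof -
  define b where "b = fps_nth bernoulli_fps"
  define t where "t = (\<lambda>k x. b k * of_real x ^ k * (of_real x :: complex) powr (s - 2))"
  define f where "f = (\<lambda>N x. \<Sum>k<N. t k x)"
  define g where "g = (\<lambda>x. \<Sum>k. t k x)"
  have "uniform_limit {0..1} f g sequentially"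
    unfolding f_def g_def
  proof (rule Weierstrass_m_test)
    fix k x assume x: "x \<in> {0..1::real}"
    have "x ^ k \<le> 1" "x powr (Re s - 2) \<le> 1"
      using x s powr_le1[of "Re s - 2" x] by (auto simp: power_le_one)
    hence "x ^ k * x powr (Re s - 2) \<le> 1 * 1" using x by (intro mult_mono) auto
    hence "norm (b k) * (x ^ k * x powr (Re s - 2)) \<le> norm (b k) * 1"
      by (intro mult_left_mono) auto
    thus "norm (t k x) \<le> norm (b k)"
      using x by (simp add: t_def norm_mult norm_power norm_powr_real_powr mult.assoc)
  qed (use summable_norm_bernoulli_fps in \<open>simp add: b_def\<close>)
  moreover have "continuous_on {0..1} (f N)" for N
    unfolding f_def[abs_def] t_def using s by (intro continuous_intros) auto
  ultimately obtain I J where I: "\<And>N. (f N has_integral I N) {0..1}"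
    and J: "(g has_integral J) {0..1}" and lim: "I \<longlonglongrightarrow> J"
    by (rule uniform_limit_integral) auto
  have "I = (\<lambda>N. \<Sum>k<N. b k / (s - 1 + of_nat k))"
  proof
    fix N
    have "(t k has_integral (b k * (1 / (s - 1 + of_nat k)))) {0..1}" for k
    proof -
      have "((\<lambda>x. b k * of_real x powr (s - 1 + of_nat k - 1)) has_integral
              (b k * (1 / (s - 1 + of_nat k)))) {0..1}"
        using s by (intro has_integral_mult_right has_integral_powr_unit_interval) simp
      moreover have "b k * of_real x powr (s - 1 + of_nat k - 1) = t k x" for x :: real
      \<comment> \<open>At 0 both sides vanish, since \<open>0 powr w\<close> is 0; elsewhere the
        exponents add.\<close>
      proof (cases "x = 0")
        case False
        have "complex_of_real x powr (s - 1 + of_nat k - 1) = of_real x powr (of_nat k + (s - 2))"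
          by (simp add: algebra_simps)
        thus ?thesis using False by (simp add: t_def powr_add)
      qed (simp add: t_def)
      ultimately show ?thesis by (simp only: )
    qed
    hence "(f N has_integral (\<Sum>k<N. b k * (1 / (s - 1 + of_nat k)))) {0..1}"
      unfolding f_def[abs_def] by (intro has_integral_sum) auto
    thus "I N = (\<Sum>k<N. b k / (s - 1 + of_nat k))" using has_integral_unique[OF I[of N]] by simp
  qed
  hence "(\<lambda>k. b k / (s - 1 + of_nat k)) sums J" using lim by (simp only: sums_def)
  moreover have "J = (LINT x:{0<..<1}|lebesgue. bose_kernel s x)"
  proof -
    have "g x = bose_kernel s x" if x: "x \<in> {0<..<1}" for x
    proof -
      have "norm (complex_of_real x) < 2 * pi" using x pi_gt3 by simp
      hence "(\<lambda>k. b k * of_real x ^ k) sums (of_real x / (exp (of_real x) - 1))"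
        using bernoulli_fps_sums[of "of_real x"] x by (simp add: b_def)
      hence "(\<lambda>k. t k x) sums (of_real x / (exp (of_real x) - 1) * of_real x powr (s - 2))"
        unfolding t_def by (rule sums_mult2)
      hence "g x = of_real x * of_real x powr (s - 2) / (exp (of_real x) - 1)"
        by (simp add: g_def sums_iff)
      also have "of_real x * of_real x powr (s - 2) = complex_of_real x powr (s - 1)"
        using x by (simp add: powr_diff power2_eq_square)
      finally show ?thesis by (simp add: bose_kernel_def exp_of_real)
    qed
    hence eq: "\<And>x. x \<in> box 0 1 \<Longrightarrow> bose_kernel s x = g x" by simp
    have "(bose_kernel s has_integral J) {0..1}"
      using has_integral_spike_interior[OF _ eq] J by (simp only: interval_cbox)
    hence "(bose_kernel s has_integral J) {0<..<1}"
      by (simp only: has_integral_Icc_iff_Ioo)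
    moreover have "set_integrable lebesgue {0<..<1} (bose_kernel s)"
      using s by (intro set_integrable_subset[OF bose_kernel_integral(1)]) auto
    ultimately show ?thesis
      using has_integral_unique has_integral_set_lebesgue by blast
  qed
  ultimately show ?thesis by (simp add: b_def)
qed

subsection \<open>The Riemann zeta function\<close>

text \<open>The entire function \<open>(s - 1) \<zeta>(s)\<close>.\<close>

definition reg_zeta :: "complex \<Rightarrow> complex" where
  "reg_zeta s = rGamma s + (s - 1) * (zeta_series s + rGamma s * zeta_tail s)"

lemma reg_zeta_holomorphic: "reg_zeta holomorphic_on UNIV"
  unfolding reg_zeta_def[abs_def]
  by (intro holomorphic_intros zeta_series_holomorphic zeta_tail_holomorphic)

text \<open>The terms with \<open>rGamma\<close> vanish at \<open>- n\<close>. The one surviving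
  term of \<open>zeta_series\<close> is \<open>B_(n+1) / (n+1)!\<close> times
  \<open>(-1)^n n!\<close>, whence the quotient by \<open>n + 1\<close>.\<close>

lemma reg_zeta_minus_of_nat:
  "reg_zeta (- of_nat n) / (- of_nat n - 1) = (- 1) ^ n * (bernoulli (n + 1) / of_nat (n + 1))"
proof -
  have "- of_nat n - 1 \<noteq> (0::complex)"
    by (metis add_uminus_conv_diff minus_add_distrib neg_equal_0_iff_equal of_nat_1 of_nat_add of_nat_eq_0_iff
        add_is_0 one_neq_zero)
  moreover have "rGamma (- of_nat n :: complex) = 0" by (simp add: rGamma_eq_zero_iff)
  ultimately have "reg_zeta (- of_nat n) / (- of_nat n - 1) = zeta_series (- of_nat n)"
    by (simp add: reg_zeta_def)
  also have "\<dots> = (- 1) ^ n * (bernoulli (n + 1) / of_nat (n + 1))"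
    by (simp add: zeta_series_minus_of_nat bernoulli_def bernoulli_fps_def del: of_nat_Suc)
  finally show ?thesis .
qed

text \<open>Riemann's integral is cut at 1, its two parts are inserted, and the factor
  \<open>Gamma s\<close> is divided out. The bound 2 comes from the expansion on the unit
  interval.\<close>

lemma reg_zeta_sums:
  assumes s: "Re s > 2"
  shows "(\<lambda>n. of_nat (Suc n) powr (- s)) sums (reg_zeta s / (s - 1))"
proof -
  define b where "b = fps_nth bernoulli_fps"
  define A where "A = (LINT x:{0<..<1}|lebesgue. bose_kernel s x)"
  have sn: "s + of_nat m \<noteq> 0" for m
  proof
    assume "s + of_nat m = 0"
    hence "Re (s + of_nat m) = 0" by simp
    thus False using s by simp
  qed
  have "({0<..} :: real set) = {0<..<1} \<union> {1..}" by auto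
  hence "(LINT x:{0<..}|lebesgue. bose_kernel s x) = A + (LINT x:{1..}|lebesgue. bose_kernel s x)"
    using set_integral_Un[of "{0<..<1}" "{1::real..}" lebesgue "bose_kernel s"]
      set_integrable_subset[OF bose_kernel_integral(1), of s "{0<..<1}"]
      set_integrable_subset[OF bose_kernel_integral(1), of s "{1..}"] s
    by (simp add: A_def subset_iff ivl_disj_int)
  hence whole: "(LINT x:{0<..}|lebesgue. bose_kernel s x) = A + zeta_tail s"
    using bose_kernel_integral_tail[of s] s by simp
  have "(\<lambda>k. b k / (s - 1 + of_nat k)) sums A"
    unfolding A_def b_def by (rule bose_kernel_integral_head[OF s])
  \<comment> \<open>The split-off term of index 0 is \<open>1 / (s - 1)\<close>; the others, times
    \<open>rGamma s\<close>, form \<open>zeta_series s\<close>.\<close>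
  hence "(\<lambda>k. b (Suc k) / (s - 1 + of_nat (Suc k))) sums (A - b 0 / (s - 1 + of_nat 0))"
    by (subst sums_Suc_iff) simp
  hence "(\<lambda>k. rGamma s * (b (Suc k) / (s - 1 + of_nat (Suc k)))) sums (rGamma s * (A - 1 / (s - 1)))"
    by (intro sums_mult) (simp add: b_def)
  moreover have "rGamma s * (b (Suc k) / (s - 1 + of_nat (Suc k))) = b (Suc k) * rGamma_quot k s" for k
    using rGamma_quot_mult[of s k, symmetric] sn[of k] by (simp add: field_simps)
  ultimately have zs: "zeta_series s = rGamma s * (A - 1 / (s - 1))"
    unfolding zeta_series_def b_def by (simp add: sums_iff)
  have "Gamma s \<noteq> 0"
    using s by (auto simp: Gamma_eq_zero_iff elim!: nonpos_Ints_cases)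
  hence "rGamma s * Gamma s = 1" by (simp add: rGamma_inverse_Gamma)
  moreover have "(\<lambda>n. rGamma s * (Gamma s * of_nat (Suc n) powr (- s))) sums (rGamma s * (A + zeta_tail s))"
    using bose_kernel_integral(2)[of s] s unfolding whole by (intro sums_mult) simp
  ultimately have "(\<lambda>n. of_nat (Suc n) powr (- s)) sums (rGamma s * (A + zeta_tail s))"
    by (simp add: mult.assoc[symmetric] del: of_nat_Suc)
  moreover have "rGamma s * (A + zeta_tail s) = reg_zeta s / (s - 1)"
  proof -
    define u where "u = 1 / (s - 1)"
    have "s \<noteq> 1" using s by auto
    hence u: "(s - 1) * u = 1" by (simp add: u_def)
    have "reg_zeta s = rGamma s + (s - 1) * (rGamma s * (A - u) + rGamma s * zeta_tail s)"
      by (simp add: reg_zeta_def zs u_def)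
    also have "\<dots> = (s - 1) * (rGamma s * (A + zeta_tail s))" using u by algebra
    finally show ?thesis using \<open>s \<noteq> 1\<close> by simp
  qed
  ultimately show ?thesis by simp
qed

text \<open>Absolute convergence turns the ordered series into an unordered sum, the form needed for
  products over several summation variables.\<close>

lemma reg_zeta_has_sum:
  assumes s: "Re s > 2"
  shows "((\<lambda>n. of_nat n powr (- s)) has_sum (reg_zeta s / (s - 1))) {1..}"
    and "(\<lambda>n. norm (of_nat n powr (- s) :: complex)) summable_on {1..}"
proof -
  have bij: "bij_betw Suc UNIV {1..}"
    by (auto simp: bij_betw_def image_iff) (metis Suc_le_D One_nat_def)
  have "summable (\<lambda>n. real (Suc n) powr (- Re s))"
    using s summable_real_powr_iff[of "- Re s"] by (intro summable_Suc_iff[THEN iffD2]) simp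
  hence sm: "summable (\<lambda>n. norm (of_nat (Suc n) powr (- s) :: complex))"
    by (simp add: norm_powr_real_powr del: of_nat_Suc)
  show "((\<lambda>n. of_nat n powr (- s)) has_sum (reg_zeta s / (s - 1))) {1..}"
    using has_sum_reindex_bij_betw[OF bij, of "\<lambda>n. of_nat n powr (- s)"]
      norm_summable_imp_has_sum[OF sm reg_zeta_sums[OF s]] by simp
  show "(\<lambda>n. norm (of_nat n powr (- s) :: complex)) summable_on {1..}"
    using summable_on_reindex_bij_betw[OF bij, of "\<lambda>n. norm (of_nat n powr (- s) :: complex)"]
      norm_summable_imp_summable_on[of "\<lambda>n. norm (of_nat (Suc n) powr (- s) :: complex)"] sm by simp
qed

subsection \<open>Multinomial expansion\<close>

text \<open>Extension by zero represents each composition by exactly one function and matches the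
  convention of \<open>index_families\<close>.\<close>

definition compositions :: "'a set \<Rightarrow> nat \<Rightarrow> ('a \<Rightarrow> nat) set" where
  "compositions A n = {k. (\<forall>p. p \<notin> A \<longrightarrow> k p = 0) \<and> sum k A = n}"

lemma finite_compositions:
  assumes "finite A"
  shows "finite (compositions A n)"
proof (rule finite_subset)
  show "compositions A n \<subseteq> {k. \<forall>p. (p \<in> A \<longrightarrow> k p \<in> {..n}) \<and> (p \<notin> A \<longrightarrow> k p = 0)}"
    using assms by (auto simp: compositions_def intro: member_le_sum)
  show "finite {k. \<forall>p. (p \<in> A \<longrightarrow> k p \<in> {..n}) \<and> (p \<notin> A \<longrightarrow> k p = 0)}"
    by (rule finite_set_of_finite_funs) (use assms in auto)
qed

lemma multinomial_insert:
  assumes "finite A" "a \<notin> A" "j \<le> n"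
  shows "multinomial n (insert a A) (k(a := j)) = of_nat (n choose j) * multinomial (n - j) A k"
proof -
  have "(\<Prod>p\<in>A. fact ((k(a := j)) p)) = (\<Prod>p\<in>A. fact (k p) :: complex)"
    using assms by (intro prod.cong) auto
  thus ?thesis
    using assms by (simp add: multinomial_def binomial_fact)
qed

text \<open>Separating the exponent \<open>j\<close> of a new element leaves a composition of
  \<open>n - j\<close> on the old set, so the induction step is the binomial theorem.\<close>

lemma multinomial_theorem:
  assumes "finite A"
  shows "(\<Sum>p\<in>A. x p) ^ n = (\<Sum>k\<in>compositions A n. multinomial n A k * (\<Prod>p\<in>A. x p ^ k p))"
  using assms
proof (induction A arbitrary: n rule: finite_induct)
  case empty
  have "compositions {} n = (if n = 0 then {\<lambda>_. 0} else {} :: ('a \<Rightarrow> nat) set)"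
    by (auto simp: compositions_def)
  thus ?case by (simp add: multinomial_def)
next
  case (insert a A)
  have "(\<Sum>k\<in>compositions (insert a A) n.
          multinomial n (insert a A) k * (\<Prod>p\<in>insert a A. x p ^ k p)) =
        (\<Sum>(j, k)\<in>Sigma {..n} (\<lambda>j. compositions A (n - j)).
          of_nat (n choose j) * multinomial (n - j) A k * (x a ^ j * (\<Prod>p\<in>A. x p ^ k p)))"
  \<comment> \<open>A composition corresponds to its value at \<open>a\<close> together with the
    function reset to 0 there.\<close>
  proof (rule sum.reindex_bij_witness[of _ "\<lambda>(j, k). k(a := j)" "\<lambda>k. (k a, k(a := 0))"], goal_cases)
    case (1 k)
    show ?case by simp
  next
    case (3 y)
    thus ?case using insert.hyps by (auto simp: compositions_def fun_eq_iff)
  next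
    case (2 k)
    moreover have "sum (k(a := 0)) A = sum k A" using insert.hyps by (intro sum.cong) auto
    ultimately show ?case using insert.hyps by (auto simp: compositions_def)
  next
    case (4 y)
    obtain j k where [simp]: "y = (j, k)" by force
    have "sum (k(a := j)) A = sum k A" using insert.hyps by (intro sum.cong) auto
    thus ?case using 4 insert.hyps by (auto simp: compositions_def)
  next
    case (5 k)
    hence le: "k a \<le> n" using insert.hyps by (auto simp: compositions_def)
    have "(\<Prod>p\<in>A. x p ^ (k(a := 0)) p) = (\<Prod>p\<in>A. x p ^ k p)"
      using insert.hyps by (intro prod.cong) auto
    moreover have "multinomial n (insert a A) k =
        of_nat (n choose k a) * multinomial (n - k a) A (k(a := 0))"
      using multinomial_insert[OF insert.hyps le, of "k(a := 0)"] by simp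
    ultimately show ?case using insert.hyps by simp
  qed
  also have "\<dots> = (\<Sum>j\<le>n. \<Sum>k\<in>compositions A (n - j).
      of_nat (n choose j) * multinomial (n - j) A k * (x a ^ j * (\<Prod>p\<in>A. x p ^ k p)))"
    using finite_compositions[OF insert.hyps(1)] by (subst sum.Sigma) auto
  also have "\<dots> = (\<Sum>j\<le>n. of_nat (n choose j) * x a ^ j * (\<Sum>p\<in>A. x p) ^ (n - j))"
    by (simp add: insert.IH sum_distrib_left mult_ac)
  also have "\<dots> = (x a + (\<Sum>p\<in>A. x p)) ^ n"
    by (simp add: binomial_ring)
  finally show ?case using insert.hyps by simp
qed

text \<open>A family is an independent choice of one composition for each pair \<open>i < j\<close>.
  The dependent product is the form in which a product of sums is multiplied out.\<close>

lemma index_families_bij: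
  fixes l :: "'r::{finite,linorder} \<Rightarrow> 'r \<Rightarrow> nat"
  shows "bij_betw (\<lambda>f i j. if i < j then f (i, j) else (\<lambda>_. 0))
           (PiE {(i, j). i < j} (\<lambda>(i, j). compositions {i..j} (l i j))) (index_families l)"
proof (rule bij_betw_byWitness[where f' = "\<lambda>k. restrict (\<lambda>(i, j). k i j) {(i, j). i < j}"])
  show "\<forall>f\<in>PiE {(i, j). i < j} (\<lambda>(i, j). compositions {i..j} (l i j)).
          restrict (\<lambda>(i, j). if i < j then f (i, j) else (\<lambda>_. 0)) {(i, j). i < j} = f"
    by (auto simp: fun_eq_iff PiE_def extensional_def restrict_def)
  show "\<forall>k\<in>index_families l. (\<lambda>i j. if i < j
          then restrict (\<lambda>(i, j). k i j) {(i, j). i < j} (i, j) else (\<lambda>_. 0)) = k"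
    by (auto simp: fun_eq_iff index_families_def restrict_def)
  show "(\<lambda>f i j. if i < j then f (i, j) else (\<lambda>_. 0)) `
          PiE {(i, j). i < j} (\<lambda>(i, j). compositions {i..j} (l i j)) \<subseteq> index_families l"
    by (fastforce simp: index_families_def compositions_def PiE_def Pi_def)
  show "(\<lambda>k. restrict (\<lambda>(i, j). k i j) {(i, j). i < j}) ` index_families l \<subseteq>
          PiE {(i, j). i < j} (\<lambda>(i, j). compositions {i..j} (l i j))"
    by (auto simp: index_families_def compositions_def PiE_def Pi_def)
qed

lemma finite_index_families: "finite (index_families l)"
proof -
  have "finite (PiE {(i, j). i < j} (\<lambda>(i, j). compositions {i..j} (l i j)))"
    by (intro finite_PiE) (auto intro: finite_compositions)
  thus ?thesis using index_families_bij[of l] bij_betw_finite by blast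
qed

text \<open>Zero extension lets every inner product run over all \<open>p\<close>; exchanging the
  two products then collects the exponents of each \<open>x p\<close>.\<close>

lemma prod_power_K_sum:
  fixes x :: "'r::{finite,linorder} \<Rightarrow> complex"
  assumes "k \<in> index_families l"
  shows "(\<Prod>(i, j)\<in>{(i, j). i < j}. \<Prod>p\<in>{i..j}. x p ^ k i j p) = (\<Prod>p\<in>UNIV. x p ^ K_sum k p)"
proof -
  have "(\<Prod>(i, j)\<in>{(i, j). i < j}. \<Prod>p\<in>{i..j}. x p ^ k i j p) =
          (\<Prod>ij\<in>{(i, j). i < j}. \<Prod>p\<in>UNIV. x p ^ k (fst ij) (snd ij) p)"
  proof (intro prod.cong refl, clarsimp)
    fix i j :: 'r assume "i < j"
    thus "(\<Prod>p\<in>{i..j}. x p ^ k i j p) = (\<Prod>p\<in>UNIV. x p ^ k i j p)"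
      using assms by (intro prod.mono_neutral_left) (auto simp: index_families_def)
  qed
  also have "\<dots> = (\<Prod>p\<in>UNIV. x p ^ (\<Sum>ij\<in>{(i, j). i < j}. k (fst ij) (snd ij) p))"
    by (subst prod.swap) (simp add: power_sum)
  also have "\<dots> = (\<Prod>p\<in>UNIV. x p ^ K_sum k p)"
  proof (intro prod.cong refl arg_cong[where f = "\<lambda>n. _ ^ n"])
    fix p
    show "(\<Sum>ij\<in>{(i, j). i < j}. k (fst ij) (snd ij) p) = K_sum k p"
      unfolding K_sum_def
    proof (rule sum.mono_neutral_cong_right)
      show "{(q, r). q \<le> p \<and> p \<le> r \<and> q \<noteq> r} \<subseteq> {(i, j). i < j}" by auto
      \<comment> \<open>Pairs whose interval does not contain \<open>p\<close> contribute exponent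
        zero, so only those counted by \<open>K_sum\<close> remain.\<close>
      have "k i j p = 0" if "i < j" "\<not> (i \<le> p \<and> p \<le> j)" for i j
        using assms that by (simp add: index_families_def)
      thus "\<forall>ij\<in>{(i, j). i < j} - {(q, r). q \<le> p \<and> p \<le> r \<and> q \<noteq> r}. k (fst ij) (snd ij) p = 0"
        by force
    qed auto
  qed
  finally show ?thesis .
qed

text \<open>The multinomial theorem is applied to each pair, and the product of the resulting sums
  is multiplied out into a sum over simultaneous choices.\<close>

lemma prod_interval_sums_expansion:
  fixes x :: "'r::{finite,linorder} \<Rightarrow> complex"
  shows "(\<Prod>(i, j)\<in>{(i, j). i < j}. (\<Sum>p\<in>{i..j}. x p) ^ l i j) =
    (\<Sum>k\<in>index_families l. (\<Prod>(i, j)\<in>{(i, j). i < j}. multinomial (l i j) {i..j} (k i j)) *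
       (\<Prod>p\<in>UNIV. x p ^ K_sum k p))"
proof -
  define T where "T = (\<lambda>(i, j) k. multinomial (l i j) {i..j} k * (\<Prod>p\<in>{i..j}. x p ^ k p))"
  have "(\<Prod>(i, j)\<in>{(i, j). i < j}. (\<Sum>p\<in>{i..j}. x p) ^ l i j) =
          (\<Prod>ij\<in>{(i, j). i < j}. \<Sum>k\<in>(case ij of (i, j) \<Rightarrow> compositions {i..j} (l i j)). T ij k)"
    by (intro prod.cong) (auto simp: T_def multinomial_theorem)
  also have "\<dots> = (\<Sum>f\<in>PiE {(i, j). i < j} (\<lambda>(i, j). compositions {i..j} (l i j)).
                     \<Prod>ij\<in>{(i, j). i < j}. T ij (f ij))"
    by (intro prod_sum_PiE) (auto intro: finite_compositions)
  also have "\<dots> = (\<Sum>f\<in>PiE {(i, j). i < j} (\<lambda>(i, j). compositions {i..j} (l i j)).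
      \<Prod>ij\<in>{(i, j). i < j}. T ij ((\<lambda>i j. if i < j then f (i, j) else (\<lambda>_. 0)) (fst ij) (snd ij)))"
    by (intro sum.cong prod.cong) auto
  also have "\<dots> = (\<Sum>k\<in>index_families l. \<Prod>ij\<in>{(i, j). i < j}. T ij (k (fst ij) (snd ij)))"
    by (rule sum.reindex_bij_betw[OF index_families_bij])
  also have "\<dots> = (\<Sum>k\<in>index_families l.
      (\<Prod>(i, j)\<in>{(i, j). i < j}. multinomial (l i j) {i..j} (k i j)) *
      (\<Prod>(i, j)\<in>{(i, j). i < j}. \<Prod>p\<in>{i..j}. x p ^ k i j p))"
    by (simp add: T_def case_prod_unfold prod.distrib)
  also have "\<dots> = (\<Sum>k\<in>index_families l.
      (\<Prod>(i, j)\<in>{(i, j). i < j}. multinomial (l i j) {i..j} (k i j)) *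
      (\<Prod>p\<in>UNIV. x p ^ K_sum k p))"
    by (intro sum.cong refl) (simp only: prod_power_K_sum)
  finally show ?thesis .
qed

lemma zeta_A_summand_diag_expansion:
  fixes l :: "'r::{finite,linorder} \<Rightarrow> 'r \<Rightarrow> nat"
  assumes m: "\<And>i. m i \<ge> 1"
  shows "zeta_A_summand (diag_array l t) m =
    (\<Sum>k\<in>index_families l. (\<Prod>(i, j)\<in>{(i, j). i < j}. multinomial (l i j) {i..j} (k i j)) *
       (\<Prod>i\<in>UNIV. of_nat (m i) powr (- (t $ i - of_nat (K_sum k i)))))"
proof -
  define f where "f = (\<lambda>i j. of_nat (\<Sum>k\<in>{i..j}. m k) powr (- diag_array l t i j))"
  have m0: "m i \<noteq> 0" for i using m[of i] by simp
  have "zeta_A_summand (diag_array l t) m = (\<Prod>(i, j)\<in>{(i, j). i \<le> j}. f i j)"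
    by (simp add: zeta_A_summand_def f_def)
  also have "{(i, j). i \<le> j} = (\<lambda>i. (i, i)) ` UNIV \<union> {(i, j). i < (j::'r)}" by auto
  also have "(\<Prod>(i, j)\<in>\<dots>. f i j) =
      (\<Prod>(i, j)\<in>(\<lambda>i. (i, i)) ` UNIV. f i j) * (\<Prod>(i, j)\<in>{(i, j). i < j}. f i j)"
    by (rule prod.union_disjoint) auto
  also have "(\<Prod>(i, j)\<in>(\<lambda>i. (i, i)) ` UNIV. f i j) = (\<Prod>i\<in>UNIV. of_nat (m i) powr (- (t $ i)))"
    by (subst prod.reindex) (auto simp: inj_on_def f_def diag_array_def)
  also have "(\<Prod>(i, j)\<in>{(i, j). i < j}. f i j) =
      (\<Prod>(i, j)\<in>{(i, j). i < j}. (\<Sum>p\<in>{i..j}. of_nat (m p)) ^ l i j)"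
  proof (intro prod.cong refl, clarsimp)
    fix i j :: 'r assume "i < j"
    \<comment> \<open>The base must be nonzero: \<open>0 powr 0\<close> is 0 whereas
      \<open>0 ^ 0\<close> is 1.\<close>
    hence "(\<Sum>k\<in>{i..j}. m k) \<noteq> 0" using m0 by auto
    hence "of_nat (\<Sum>k\<in>{i..j}. m k) \<noteq> (0 :: complex)" by (simp only: of_nat_eq_0_iff not_False_eq_True)
    thus "f i j = (\<Sum>p\<in>{i..j}. of_nat (m p)) ^ l i j"
      using \<open>i < j\<close> by (auto simp: f_def diag_array_def)
  qed
  also have "(\<Prod>i\<in>UNIV. of_nat (m i) powr (- (t $ i))) * \<dots> =
    (\<Sum>k\<in>index_families l. (\<Prod>(i, j)\<in>{(i, j). i < j}. multinomial (l i j) {i..j} (k i j)) *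
       (\<Prod>i\<in>UNIV. of_nat (m i) powr (- (t $ i)) * of_nat (m i) ^ K_sum k i))"
    by (simp add: prod_interval_sums_expansion sum_distrib_left prod.distrib mult_ac)
  also have "\<dots> = (\<Sum>k\<in>index_families l.
       (\<Prod>(i, j)\<in>{(i, j). i < j}. multinomial (l i j) {i..j} (k i j)) *
       (\<Prod>i\<in>UNIV. of_nat (m i) powr (- (t $ i - of_nat (K_sum k i)))))"
  proof -
    \<comment> \<open>The power produced by the expansion is absorbed as a shift of the diagonal
      exponent.\<close>
    have "of_nat (m i) powr (- (t $ i)) * of_nat (m i) ^ n =
        (of_nat (m i) powr (- (t $ i - of_nat n)) :: complex)" for i n
      using m0[of i] by (simp add: powr_diff powr_minus divide_inverse)
    thus ?thesis by (simp only:)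
  qed
  finally show ?thesis .
qed

subsection \<open>The diagonal continuation\<close>

text \<open>Absolute summability of each factor makes the family on the product set absolutely
  summable, so its sum factorises.\<close>

lemma has_sum_prod_functions:
  fixes f :: "'r::finite \<Rightarrow> nat \<Rightarrow> complex"
  assumes sum: "\<And>i. (f i has_sum S i) A" and abs: "\<And>i. (\<lambda>n. norm (f i n)) summable_on A"
  shows "((\<lambda>m. \<Prod>i\<in>UNIV. f i (m i)) has_sum (\<Prod>i\<in>UNIV. S i)) {m. \<forall>i. m i \<in> A}"
proof -
  have eq: "PiE UNIV (\<lambda>_. A) = {m :: 'r \<Rightarrow> nat. \<forall>i. m i \<in> A}"
    by (auto simp: PiE_def Pi_def)
  have "Infinite_Set_Sum.abs_summable_on (\<lambda>m. \<Prod>i\<in>UNIV. f i (m i)) (PiE UNIV (\<lambda>_. A))"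
    using abs by (intro abs_summable_on_prod_PiE) (auto simp: abs_summable_equivalent[symmetric])
  hence "(\<lambda>m. \<Prod>i\<in>UNIV. f i (m i)) summable_on PiE UNIV (\<lambda>_. A)"
    unfolding abs_summable_equivalent[symmetric] by (rule abs_summable_summable)
  hence "((\<lambda>m. \<Prod>i\<in>UNIV. f i (m i)) has_sum
           infsum (\<lambda>m. \<Prod>i\<in>UNIV. f i (m i)) (PiE UNIV (\<lambda>_. A))) (PiE UNIV (\<lambda>_. A))"
    by (rule has_sum_infsum)
  also have "infsum (\<lambda>m. \<Prod>i\<in>UNIV. f i (m i)) (PiE UNIV (\<lambda>_. A)) = (\<Prod>i\<in>UNIV. infsum (f i) A)"
    using abs by (intro infsum_prod_PiE_abs) auto
  also have "\<dots> = (\<Prod>i\<in>UNIV. S i)"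
    by (simp add: infsumI[OF sum])
  finally show ?thesis by (simp only: eq)
qed

lemma has_sum_finite_sum:
  fixes f :: "'b \<Rightarrow> 'a \<Rightarrow> 'c::topological_comm_monoid_add"
  assumes "finite B" "\<And>k. k \<in> B \<Longrightarrow> (f k has_sum S k) A"
  shows "((\<lambda>x. \<Sum>k\<in>B. f k x) has_sum (\<Sum>k\<in>B. S k)) A"
  using assms by (induction B rule: finite_induct) (auto intro: has_sum_add)

text \<open>Here \<open>reg_zeta z / (z - 1)\<close> stands for the continued Riemann zeta function
  at \<open>z\<close>; at its pole the quotient takes the default value 0.\<close>

definition zeta_A_diag_formula ::
  "('r::{finite,linorder} \<Rightarrow> 'r \<Rightarrow> nat) \<Rightarrow> (complex, 'r) vec \<Rightarrow> complex" where
  "zeta_A_diag_formula l t =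
    (\<Sum>k\<in>index_families l. (\<Prod>(i, j)\<in>{(i, j). i < j}. multinomial (l i j) {i..j} (k i j)) *
       (\<Prod>i\<in>UNIV. reg_zeta (t $ i - of_nat (K_sum k i)) / (t $ i - of_nat (K_sum k i) - 1)))"

text \<open>The hypothesis puts every shifted argument into the half-plane \<open>Re z > 2\<close>
  of \<open>reg_zeta_has_sum\<close>; the expansion of the summand is then summed factor by
  factor.\<close>

lemma zeta_A_summand_diag_has_sum:
  fixes l :: "'r::{finite,linorder} \<Rightarrow> 'r \<Rightarrow> nat"
  assumes t: "\<And>k i. k \<in> index_families l \<Longrightarrow> Re (t $ i) > real (K_sum k i) + 2"
  shows "(zeta_A_summand (diag_array l t) has_sum zeta_A_diag_formula l t)
    {m. \<forall>i. m i \<ge> 1}"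
proof -
  have "((\<lambda>m. \<Sum>k\<in>index_families l.
      (\<Prod>(i, j)\<in>{(i, j). i < j}. multinomial (l i j) {i..j} (k i j)) *
      (\<Prod>i\<in>UNIV. of_nat (m i) powr (- (t $ i - of_nat (K_sum k i))))) has_sum
    (\<Sum>k\<in>index_families l. (\<Prod>(i, j)\<in>{(i, j). i < j}. multinomial (l i j) {i..j} (k i j)) *
       (\<Prod>i\<in>UNIV. reg_zeta (t $ i - of_nat (K_sum k i)) / (t $ i - of_nat (K_sum k i) - 1))))
    {m. \<forall>i. m i \<in> {1..}}"
    by (intro has_sum_finite_sum has_sum_cmult_right has_sum_prod_functions reg_zeta_has_sum
          finite_index_families) (use t in \<open>auto simp: algebra_simps\<close>)
  hence "((\<lambda>m. \<Sum>k\<in>index_families l.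
      (\<Prod>(i, j)\<in>{(i, j). i < j}. multinomial (l i j) {i..j} (k i j)) *
      (\<Prod>i\<in>UNIV. of_nat (m i) powr (- (t $ i - of_nat (K_sum k i))))) has_sum
    (\<Sum>k\<in>index_families l. (\<Prod>(i, j)\<in>{(i, j). i < j}. multinomial (l i j) {i..j} (k i j)) *
       (\<Prod>i\<in>UNIV. reg_zeta (t $ i - of_nat (K_sum k i)) / (t $ i - of_nat (K_sum k i) - 1))))
    {m. \<forall>i. m i \<ge> 1}"
    by simp
  thus ?thesis
    unfolding zeta_A_diag_formula_def
    by (rule has_sum_cong[THEN iffD1, rotated]) (simp add: zeta_A_summand_diag_expansion)
qed

text \<open>The factor with shift \<open>K\<close> has its pole at \<open>K + 1\<close>, and all
  shifts are at most \<open>M\<close>. The product of all \<open>t $ i - n - 1\<close> with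
  \<open>n \<le> M\<close> is therefore a common denominator.\<close>

lemma zeta_A_diag_continuation_quotient:
  fixes l :: "'r::{finite,linorder} \<Rightarrow> 'r \<Rightarrow> nat"
  obtains N H and M :: nat where
    "mv_holomorphic_on N UNIV" "mv_holomorphic_on H UNIV"
    "\<And>t. H t \<noteq> 0 \<longleftrightarrow> (\<forall>i. t $ i \<notin> (\<lambda>n. of_nat n + 1) ` {..M})"
    "\<And>t. H t \<noteq> 0 \<Longrightarrow> N t / H t = zeta_A_diag_formula l t"
    "\<And>k i. k \<in> index_families l \<Longrightarrow> K_sum k i \<le> M"
proof -
  define c where
    "c = (\<lambda>k. \<Prod>(i, j)\<in>{(i, j). i < j}. multinomial (l i j) {i..j} ((k :: 'r \<Rightarrow> 'r \<Rightarrow> 'r \<Rightarrow> nat) i j))"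
  \<comment> \<open>A crude common bound: the sum of all shifts dominates each of them.\<close>
  define M where "M = (\<Sum>k\<in>index_families l. \<Sum>i\<in>UNIV. K_sum k i)"
  have M: "K_sum k i \<le> M" if "k \<in> index_families l" for k i
  proof -
    have "K_sum k i \<le> (\<Sum>i\<in>UNIV. K_sum k i)" by (rule member_le_sum) auto
    also have "\<dots> \<le> M"
      unfolding M_def using that finite_index_families
      by (intro member_le_sum[of k "index_families l" "\<lambda>k. \<Sum>i\<in>UNIV. K_sum k i"]) auto
    finally show ?thesis .
  qed
  define h where "h = (\<lambda>z::complex. \<Prod>n\<le>M. z - of_nat n - 1)"
  \<comment> \<open>Passing to the common denominator \<open>h\<close> multiplies the numerator by
    all its linear factors except the one already present.\<close>
  define e where "e = (\<lambda>K (z::complex). reg_zeta (z - of_nat K) * (\<Prod>n\<in>{..M} - {K}. z - of_nat n - 1))"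
  define N where "N = (\<lambda>t :: (complex, 'r) vec. \<Sum>k\<in>index_families l. c k * (\<Prod>i\<in>UNIV. e (K_sum k i) (t $ i)))"
  have e: "e K holomorphic_on UNIV" for K
    unfolding e_def
    by (intro holomorphic_intros holomorphic_on_compose_gen[OF _ reg_zeta_holomorphic, unfolded o_def]) auto
  have h: "h holomorphic_on UNIV"
    unfolding h_def by (intro holomorphic_intros)
  have "mv_holomorphic_on N UNIV"
    unfolding N_def
    by (intro mv_holomorphic_on_sum mv_holomorphic_on_mult mv_holomorphic_on_const
          mv_holomorphic_on_prod mv_holomorphic_on_nth e)
  moreover have "mv_holomorphic_on (\<lambda>t :: (complex, 'r) vec. \<Prod>i\<in>UNIV. h (t $ i)) UNIV"
    by (intro mv_holomorphic_on_prod mv_holomorphic_on_nth h)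
  moreover have "N t / (\<Prod>i\<in>UNIV. h (t $ i)) = zeta_A_diag_formula l t" if "(\<Prod>i\<in>UNIV. h (t $ i)) \<noteq> 0" for t
  proof -
    have quot: "e K z / h z = reg_zeta (z - of_nat K) / (z - of_nat K - 1)"
      if "h z \<noteq> 0" "K \<le> M" for z K
    proof -
      have "h z = (z - of_nat K - 1) * (\<Prod>n\<in>{..M} - {K}. z - of_nat n - 1)"
        unfolding h_def using that by (subst prod.remove[of _ K]) auto
      thus ?thesis using that by (simp add: e_def)
    qed
    have "N t / (\<Prod>i\<in>UNIV. h (t $ i)) =
            (\<Sum>k\<in>index_families l. c k * (\<Prod>i\<in>UNIV. e (K_sum k i) (t $ i) / h (t $ i)))"
      by (simp add: N_def sum_divide_distrib prod_dividef)
    also have "\<dots> = zeta_A_diag_formula l t"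
      unfolding zeta_A_diag_formula_def c_def using that M
      by (intro sum.cong prod.cong arg_cong2[where f = "(*)"] refl quot) auto
    finally show ?thesis .
  qed
  moreover have "(\<Prod>i\<in>UNIV. h (t $ i)) \<noteq> 0 \<longleftrightarrow> (\<forall>i. t $ i \<notin> (\<lambda>n. of_nat n + 1) ` {..M})"
    for t :: "(complex, 'r) vec"
    by (auto simp: h_def algebra_simps image_iff)
  ultimately show thesis using M by (intro that)
qed

section \<open>Existence, uniqueness and evaluation of the diagonal value\<close>

theorem proposition24:
  fixes l :: "'r::{finite,linorder} \<Rightarrow> 'r \<Rightarrow> nat"
  shows "has_zeta_A_diag l (zeta_A_diag l) \<and>
    zeta_A_diag l =
      (\<Sum>k\<in>index_families l.
         (\<Prod>(i, j)\<in>{(i, j). i < j}. multinomial (l i j) {i..j} (k i j)) *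
         (\<Prod>i\<in>UNIV. (-1) ^ (l i i + K_sum k i) *
            (bernoulli (l i i + K_sum k i + 1) / of_nat (l i i + K_sum k i + 1))))"
proof -
  define Z where "Z = zeta_A_diag_formula l"
  define a :: "(complex, 'r) vec" where "a = (\<chi> i. - of_nat (l i i))"
  obtain N H M where N: "mv_holomorphic_on N UNIV" and H: "mv_holomorphic_on H UNIV"
    and H_nz: "\<And>t. H t \<noteq> 0 \<longleftrightarrow> (\<forall>i. t $ i \<notin> (\<lambda>n. of_nat n + 1) ` {..M})"
    and Z: "\<And>t. H t \<noteq> 0 \<Longrightarrow> N t / H t = Z t"
    and M: "\<And>k i. k \<in> index_families l \<Longrightarrow> K_sum k i \<le> M"
    unfolding Z_def by (rule zeta_A_diag_continuation_quotient[of l]) blast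
  \<comment> \<open>In each coordinate the only possible poles are \<open>1, ..., M + 1\<close>;
    \<open>P\<close> is their complement.\<close>
  define P where "P = - (\<lambda>n. of_nat n + 1 :: complex) ` {..M}"
  have P: "open P" by (auto simp: P_def intro!: open_Compl finite_imp_closed)
  have H_P: "H t \<noteq> 0 \<longleftrightarrow> (\<forall>i. t $ i \<in> P)" for t
    unfolding H_nz by (simp add: P_def)
  \<comment> \<open>Thus the excluded values lie to the right of the target point \<open>a\<close>
    and to the left of the region of convergence used below.\<close>
  have in_P: "z \<in> P" if "Re z < 1 \<or> Re z > real M + 1" for z
    using that by (auto simp: P_def)
  have a_P: "a $ i \<in> P" for i
    by (rule in_P) (simp add: a_def)
  have Z_a: "Z a = (\<Sum>k\<in>index_families l.
         (\<Prod>(i, j)\<in>{(i, j). i < j}. multinomial (l i j) {i..j} (k i j)) *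
         (\<Prod>i\<in>UNIV. (-1) ^ (l i i + K_sum k i) *
            (bernoulli (l i i + K_sum k i + 1) / of_nat (l i i + K_sum k i + 1))))"
  proof -
    \<comment> \<open>At \<open>a\<close> every shifted argument is a nonpositive integer, where the
      zeta value is a Bernoulli quotient.\<close>
    have "a $ i - of_nat n = - of_nat (l i i + n)" for i n by (simp add: a_def)
    thus ?thesis unfolding Z_def zeta_A_diag_formula_def by (simp only: reg_zeta_minus_of_nat)
  qed
  have Z_has_sum: "(zeta_A_summand (diag_array l t) has_sum Z t) {m. \<forall>i. m i \<ge> 1}"
    if "\<And>i. Re (t $ i) > real M + 2" for t
    unfolding Z_def
  proof (rule zeta_A_summand_diag_has_sum)
    fix k i assume "k \<in> index_families l"
    thus "Re (t $ i) > real (K_sum k i) + 2" using M[of k i] that[of i] by linarith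
  qed
  have cont: "continuous_on {t. \<forall>i. t $ i \<in> P} (\<lambda>t. N t / H t)"
    by (intro mv_holomorphic_on_imp_continuous_on mv_holomorphic_on_divide
          mv_holomorphic_on_subset[OF N] mv_holomorphic_on_subset[OF H]) (auto simp: H_P)
  have open_box: "open {t :: (complex, 'r) vec. \<forall>i. t $ i \<in> B}" if "open B" for B
  proof -
    have "{t :: (complex, 'r) vec. \<forall>i. t $ i \<in> B} = (\<Inter>i. (\<lambda>t. t $ i) -` B)" by auto
    thus ?thesis using that by (auto intro!: open_INT open_vimage_vec_nth)
  qed
  have ex: "\<exists>F. zeta_A_diag_continuation l F"
  proof -
    have "\<exists>t. H t \<noteq> 0" using a_P H_P by blast
    from mv_meromorphic_removed_singularities_exists[OF N H this] obtain F
      where F: "mv_meromorphic_on F UNIV" "mv_removed_singularities F"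
        "\<And>t. H t \<noteq> 0 \<Longrightarrow> F t = N t / H t" by blast
    have "(zeta_A_summand (diag_array l t) has_sum F t) {m. \<forall>i. m i \<ge> 1}"
      if t: "\<forall>i. Re (t $ i) > real M + 2" for t
    proof -
      have "H t \<noteq> 0" unfolding H_P
      proof
        fix i show "t $ i \<in> P" using t[rule_format, of i] by (intro in_P) simp
      qed
      thus ?thesis using Z_has_sum[of t] t F(3) Z by simp
    qed
    thus ?thesis using F unfolding zeta_A_diag_continuation_def by blast
  qed
  have lim: "(F \<longlongrightarrow> Z a) (at a) \<and>
      (\<forall>is. distinct is \<and> set is = UNIV \<longrightarrow> iterated_limit F a is a (Z a))"
    if F: "zeta_A_diag_continuation l F" for F
  proof -
    obtain C where C: "\<And>t. (\<And>i. Re (t $ i) > C) \<Longrightarrow>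
        (zeta_A_summand (diag_array l t) has_sum F t) {m. \<forall>i. m i \<ge> 1}"
      using F unfolding zeta_A_diag_continuation_def by blast
    \<comment> \<open>On this half-space both the series for \<open>F\<close> and the expansion for
      \<open>Z\<close> converge, so uniqueness of sums equates them;
      \<open>mv_meromorphic_unique\<close> extends the equality to all points with
      \<open>H t \<noteq> 0\<close>.\<close>
    define B where "B = {z. Re z > max C (real M + 2)}"
    define V where "V = {t :: (complex, 'r) vec. \<forall>i. t $ i \<in> B}"
    have "open V"
      unfolding V_def by (rule open_box) (simp only: B_def open_halfspace_Re_gt)
    moreover have "(\<chi> i. of_real (max C (real M + 2) + 1)) \<in> V"
      by (simp only: V_def B_def mem_Collect_eq vec_lambda_beta Re_complex_of_real less_add_one simp_thms)
    moreover have "F t * H t = N t" if "t \<in> V" for t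
    proof -
      have t: "Re (t $ i) > C" "Re (t $ i) > real M + 2" for i
        using that by (auto simp: V_def B_def)
      have "H t \<noteq> 0" unfolding H_P
      proof
        fix i show "t $ i \<in> P" using t(2)[of i] by (intro in_P) simp
      qed
      moreover have "F t = Z t"
        using C[of t] Z_has_sum[of t] t has_sum_unique by blast
      ultimately show ?thesis using Z[of t] by (simp add: field_simps)
    qed
    ultimately have F_eq: "F t = N t / H t" if "H t \<noteq> 0" for t
      using F that unfolding zeta_A_diag_continuation_def
      by (intro mv_meromorphic_unique[OF _ _ N H]) auto
    have F_cont: "continuous_on {t. \<forall>i. t $ i \<in> P} F"
      using cont by (rule continuous_on_eq) (simp add: F_eq H_P)
    have "F a = Z a" using F_eq[of a] Z[of a] H_P[of a] a_P by simp
    moreover have "(F \<longlongrightarrow> F a) (at a)"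
      using F_cont a_P unfolding continuous_on_eq_continuous_at[OF open_box[OF P]] isCont_def by simp
    moreover have "iterated_limit F a is a (F a)" for "is"
    proof -
      have "(\<chi> i. if i \<in> set is then a $ i else a $ i) = a" by (simp add: vec_eq_iff)
      thus ?thesis
        using iterated_limit_of_continuous[of "\<lambda>_. P" a F "is" a] P a_P F_cont by simp
    qed
    ultimately show ?thesis by simp
  qed
  have has: "has_zeta_A_diag l (Z a)"
    using ex lim unfolding has_zeta_A_diag_def Let_def a_def by blast
  \<comment> \<open>Since a continuation exists, another candidate would be a second limit of the
    same function at \<open>a\<close>; hence the \<open>THE\<close> in \<open>zeta_A_diag\<close> is
    determined.\<close>
  have "w = Z a" if "has_zeta_A_diag l w" for w
  proof -
    obtain F where F: "zeta_A_diag_continuation l F" using ex by blast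
    have "(F \<longlongrightarrow> w) (at a)"
      using that F unfolding has_zeta_A_diag_def Let_def a_def by blast
    thus ?thesis using lim[OF F] tendsto_unique[of "at a" F] by auto
  qed
  with has have "zeta_A_diag l = Z a"
    unfolding zeta_A_diag_def by (intro the_equality)
  thus ?thesis using has Z_a by simp
qed

end
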